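(* Let $P_0$ be a distribution on $\mathbb{R}^d$. Let $\mathcal{D}_{\mathrm{null}}$ be a sample of $n_0$ i.i.d. points from $P_0$, split into $\mathcal{D}_{\mathrm{train}}$ and $\mathcal{D}_{\mathrm{cal}}=(X_1,\dots,X_n)$ with $1<n<n_0$, and let $\mathcal{D}_{\mathrm{test}}=(X_{n+1},\dots,X_{n+m})$ be independent points in $\mathbb{R}^d$, independent of $\mathcal{D}_{\mathrm{null}}$, each either distributed as $P_0$ or not; let $\mathcal{H}_0=\{i\in\{1,\dots,m\}:X_{n+i}\sim P_0\}$. Let $S_i=g(X_i)$, $i\in\{1,\dots,n+m\}$, where the score function $g=g(\cdot;\mathcal{D}_{\mathrm{train}},(X_1,\dots,X_{n+m}))$ is invariant under permutations of $(X_1,\dots,X_{n+m})$, and assume the scores have almost surely no ties. Let $p_i=\frac1{n+1}\big(1+\sum_{j=1}^n\mathbf{1}\{S_j\geq S_{n+i}\}\big)$, $i\in\{1,\dots,m\}$, and $\mathcal{R}(t)=\{i\in\{1,\dots,m\}:p_i\leq t\}$. Let $\delta\in(0,1)$ and let $\hat m_0$ be any random variable such that $$\hat m_0\geq\max\Big\{r\in\{1,\dots,m\}:\inf_{t\in(0,1)}\frac{\sum_{i=1}^m\mathbf{1}\{p_i>t\}+r\lambda^{\mathrm{DKW}}_{\delta,n,r}}{1-I_n(t)}\geq r\Big\},$$ the maximum being taken equal to $m$ if the set is empty. Then with probability at least $1-\delta$, for all $t\in(0,1)$, $$\mathrm{FDP}(\mathcal{R}(t))\leq\frac{\hat m_0I_n(t)+\hat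 m_0\lambda^{\mathrm{DKW}}_{\delta,n,\hat m_0}}{1\vee|\mathcal{R}(t)|}.$$
   Context: $\mathrm{FDP}(R)=|R\cap\mathcal{H}_0|/(|R|\vee1)$ for $R\subset\{1,\dots,m\}$. $I_n(t)=\lfloor(n+1)t\rfloor/(n+1)$. For integers $n,r\geq1$ and $\delta\in(0,1)$, with $\tau_{n,r}=nr/(n+r)$, $\lambda^{\mathrm{DKW}}_{\delta,n,r}=\Psi^{(k)}(1)$ for a fixed integer $k\geq1$ ($\Psi$ iterated $k$ times), where $\Psi(x)=1\wedge\Big(\frac{\log(1/\delta)+\log(1+\sqrt{2\pi}\,2\tau_{n,r}x/(n+r)^{1/2})}{2\tau_{n,r}}\Big)^{1/2}$. *)

theory Defs
  imports "HOL-Probability.Probability"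
begin

definition I_n :: "nat \<Rightarrow> real \<Rightarrow> real" where
  "I_n n t = real_of_int \<lfloor>(real n + 1) * t\<rfloor> / (real n + 1)"

definition tau_nr :: "nat \<Rightarrow> nat \<Rightarrow> real" where
  "tau_nr n r = real n * real r / (real n + real r)"

definition Psi_DKW :: "real \<Rightarrow> nat \<Rightarrow> nat \<Rightarrow> real \<Rightarrow> real" where
  "Psi_DKW \<delta> n r x = min 1 (sqrt ((ln (1 / \<delta>)
      + ln (1 + sqrt (2 * pi) * 2 * tau_nr n r * x / sqrt (real n + real r)))
      / (2 * tau_nr n r)))"

definition lambda_DKW :: "nat \<Rightarrow> real \<Rightarrow> nat \<Rightarrow> nat \<Rightarrow> real" where
  "lambda_DKW k \<delta> n r = (Psi_DKW \<delta> n r ^^ k) 1"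

definition FDP :: "nat set \<Rightarrow> nat set \<Rightarrow> real" where
  "FDP H0 R = real (card (R \<inter> H0)) / real (max (card R) 1)"

text \<open>Scores S_i = g(X_i; D_train, (X_1,...,X_{n+m})); training sample T_1..T_{n0-n}.\<close>
definition score ::
  "((nat \<Rightarrow> 'x) \<Rightarrow> (nat \<Rightarrow> 'x) \<Rightarrow> 'x \<Rightarrow> real) \<Rightarrow> nat \<Rightarrow> nat \<Rightarrow> nat
     \<Rightarrow> (nat \<Rightarrow> 'o \<Rightarrow> 'x) \<Rightarrow> (nat \<Rightarrow> 'o \<Rightarrow> 'x) \<Rightarrow> nat \<Rightarrow> 'o \<Rightarrow> real" where
  "score g n0 n m T X i \<omega> =
     g (\<lambda>j\<in>{1..n0 - n}. T j \<omega>) (\<lambda>j\<in>{1..n + m}. X j \<omega>) (X i \<omega>)"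

definition conf_pval :: "nat \<Rightarrow> (nat \<Rightarrow> real) \<Rightarrow> nat \<Rightarrow> real" where
  "conf_pval n S i = (1 + real (card {j \<in> {1..n}. S j \<ge> S (n + i)})) / (real n + 1)"

definition rej_set :: "nat \<Rightarrow> (nat \<Rightarrow> real) \<Rightarrow> real \<Rightarrow> nat set" where
  "rej_set m p t = {i \<in> {1..m}. p i \<le> t}"

definition m0_bound :: "nat \<Rightarrow> real \<Rightarrow> nat \<Rightarrow> nat \<Rightarrow> (nat \<Rightarrow> real) \<Rightarrow> nat" where
  "m0_bound k \<delta> n m p =
     (let A = {r \<in> {1..m}.
          (INF t \<in> {0<..<1}. (real (card {i \<in> {1..m}. p i > t}) + real r * lambda_DKW k \<delta> n r)
                              / (1 - I_n n t)) \<ge> real r}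
      in if A = {} then m else Max A)"

end

theory Submission
  imports Defs "HOL-Real_Asymp.Real_Asymp"
begin

text \<open>
  By exchangeability, every n-element subset of the pooled calibration and null test scores is
  equally likely to be the calibration set, so the probability that the null p-values exceed
  their envelope is the fraction of subsets for which they do. Reading the pooled scores upwards
  and recording the numbers x, y of null test and calibration scores still to come gives an
  urn walk, and an excess by more than \<open>\<epsilon>\<close> forces the walk across the line
  \<open>N x = c + r (y + 1)\<close>, where \<open>N = n + 1\<close>, r is the number of nulls and
  \<open>c = \<epsilon> N r\<close>. The crossing probability of a Brownian bridge suggests the barrier
  \<open>exp (- 6 c (c + r (y + 1) - N x) / ((N + 2 r) N x + (2 N + r) r (y + 1)))\<close>. With these weights in
  the denominator it is a supersolution of the urn recursion, and its value at the start (r, n) is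
  \<open>exp (- 2 \<epsilon>\<^sup>2 N r / (N + r))\<close>, at most \<open>exp (- 2 \<tau> \<epsilon>\<^sup>2)\<close>. This is sharper than the bound
  with the logarithmic correction from which \<open>\<lambda>\<close> is built.

  On the complementary event the number of nulls belongs to the set whose maximum is estimated, so
  the estimate is at least r, and the map from r to \<open>r \<lambda>\<close> is nondecreasing.
\<close>

section \<open>Exponential inequalities\<close>

lemma nonneg_of_deriv_nonneg:
  fixes f f' :: "real \<Rightarrow> real"
  assumes "\<And>x. 0 \<le> x \<Longrightarrow> (f has_real_derivative f' x) (at x)"
    and "\<And>x. 0 \<le> x \<Longrightarrow> 0 \<le> f' x" and "f 0 = 0" and "0 \<le> z"
  shows "0 \<le> f z"
  using DERIV_nonneg_imp_nondecreasing[of 0 z f] assms by force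

text \<open>Meant for logarithmic quotients such as \<open>ln (exp z - 1) - ln z\<close>, which are
  singular at 0 but have a one-sided limit; that limit takes the place of the value at 0.\<close>

lemma nonneg_of_deriv_nonneg_at_right:
  fixes f f' :: "real \<Rightarrow> real"
  assumes d: "\<And>x. 0 < x \<Longrightarrow> (f has_real_derivative f' x) (at x)"
    and n: "\<And>x. 0 < x \<Longrightarrow> 0 \<le> f' x" and l: "(f \<longlongrightarrow> 0) (at_right 0)" and z: "0 < z"
  shows "0 \<le> f z"
proof (rule tendsto_upperbound[OF l])
  show "\<forall>\<^sub>F x in at_right 0. f x \<le> f z"
    unfolding eventually_at_right[OF z]
  proof (intro exI[of _ z] conjI allI impI z)
    fix y assume y: "0 < y" "y < z"
    have "\<exists>D. (f has_real_derivative D) (at x) \<and> 0 \<le> D" if "y \<le> x" for x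
      using d[of x] n[of x] that y by auto
    then show "f y \<le> f z" using y by (intro DERIV_nonneg_imp_nondecreasing[of y z f]) auto
  qed
qed simp

text \<open>Compares \<open>exp z\<close> with its Pade approximant
  \<open>(12 + 6 z + z^2) / (12 - 6 z + z^2)\<close>. The difference, cleared of denominators,
  vanishes at 0 together with its first two derivatives, and its third derivative is
  \<open>exp x * x^2\<close>.\<close>

lemma expm1_pade_lower:
  fixes z :: real
  assumes "0 \<le> z"
  shows "12 * z \<le> (exp z - 1) * (12 - 6 * z + z\<^sup>2)"
proof -
  have 3: "0 \<le> exp x * (2 - 2 * x + x\<^sup>2) - 2" if "0 \<le> x" for x :: real
    by (rule nonneg_of_deriv_nonneg[where f' = "\<lambda>x. exp x * x\<^sup>2"])
      (use that in \<open>auto intro!: derivative_eq_intros simp: algebra_simps power2_eq_square\<close>)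
  have 2: "0 \<le> exp x * (6 - 4 * x + x\<^sup>2) - 6 - 2 * x" if "0 \<le> x" for x :: real
    by (rule nonneg_of_deriv_nonneg[where f' = "\<lambda>x. exp x * (2 - 2 * x + x\<^sup>2) - 2", OF _ 3])
      (use that in \<open>auto intro!: derivative_eq_intros simp: algebra_simps power2_eq_square\<close>)
  have "0 \<le> exp z * (12 - 6 * z + z\<^sup>2) - 12 - 6 * z - z\<^sup>2"
    by (rule nonneg_of_deriv_nonneg[where f' = "\<lambda>x. exp x * (6 - 4 * x + x\<^sup>2) - 6 - 2 * x", OF _ 2])
      (use assms in \<open>auto intro!: derivative_eq_intros simp: algebra_simps power2_eq_square\<close>)
  then show ?thesis by (simp add: algebra_simps)
qed

text \<open>The Bernoulli series is
  \<open>180 z / (exp z - 1) = 180 - 90 z + 15 z^2 - z^4 / 4 + ...\<close>; the bound truncates it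
  and subtracts \<open>z^3\<close> as slack. After four differentiations only an exponential times a
  positive cubic remains.\<close>

lemma expm1_cubic_upper:
  fixes z :: real
  assumes "0 \<le> z"
  shows "(exp z - 1) * (180 - 90 * z + 15 * z\<^sup>2 - z ^ 3) \<le> 180 * z"
proof -
  have p: "0 \<le> 24 + 6 * x - 3 * x\<^sup>2 + x ^ 3" if "0 \<le> x" for x :: real
  proof -
    have "24 + 6 * x - 3 * x\<^sup>2 + x ^ 3 = 24 + x * ((x - 3/2)\<^sup>2 + 15/4)"
      by (simp add: algebra_simps power2_eq_square power3_eq_cube)
    also have "0 \<le> \<dots>" using that by (intro add_nonneg_nonneg mult_nonneg_nonneg) auto
    finally show ?thesis .
  qed
  have 5: "0 \<le> exp x * (24 + 6 * x - 3 * x\<^sup>2 + x ^ 3)" if "0 \<le> x" for x :: real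
    using p[OF that] by simp
  have 4: "0 \<le> exp x * (6 + 18 * x - 6 * x\<^sup>2 + x ^ 3) - 6" if "0 \<le> x" for x :: real
    by (rule nonneg_of_deriv_nonneg[where f' = "\<lambda>x. exp x * (24 + 6 * x - 3 * x\<^sup>2 + x ^ 3)"
          and f = "\<lambda>x. exp x * (6 + 18 * x - 6 * x\<^sup>2 + x ^ 3) - 6", OF _ 5])
      (use that in \<open>auto intro!: derivative_eq_intros simp: algebra_simps power2_eq_square power3_eq_cube\<close>)
  have 3: "0 \<le> 30 - 6 * x - exp x * (30 - 36 * x + 9 * x\<^sup>2 - x ^ 3)" if "0 \<le> x" for x :: real
    by (rule nonneg_of_deriv_nonneg[where f' = "\<lambda>x. exp x * (6 + 18 * x - 6 * x\<^sup>2 + x ^ 3) - 6", OF _ 4])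
      (use that in \<open>auto intro!: derivative_eq_intros simp: algebra_simps power2_eq_square power3_eq_cube\<close>)
  have 2: "0 \<le> 90 + 30 * x - 3 * x\<^sup>2 - exp x * (90 - 60 * x + 12 * x\<^sup>2 - x ^ 3)" if "0 \<le> x" for x :: real
    by (rule nonneg_of_deriv_nonneg[where f' = "\<lambda>x. 30 - 6 * x - exp x * (30 - 36 * x + 9 * x\<^sup>2 - x ^ 3)", OF _ 3])
      (use that in \<open>auto intro!: derivative_eq_intros simp: algebra_simps power2_eq_square power3_eq_cube\<close>)
  have "0 \<le> 180 + 90 * z + 15 * z\<^sup>2 - z ^ 3 - exp z * (180 - 90 * z + 15 * z\<^sup>2 - z ^ 3)"
    by (rule nonneg_of_deriv_nonneg[where f' = "\<lambda>x. 90 + 30 * x - 3 * x\<^sup>2 - exp x * (90 - 60 * x + 12 * x\<^sup>2 - x ^ 3)", OF _ 2])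
      (use assms in \<open>auto intro!: derivative_eq_intros simp: algebra_simps power2_eq_square power3_eq_cube\<close>)
  then show ?thesis by (simp add: algebra_simps)
qed

text \<open>Since \<open>exp z - 1 = 2 exp (z / 2) sinh (z / 2)\<close>, this is
  \<open>sinh u \<le> u exp (u^2 / 6)\<close> with \<open>u = z / 2\<close>. The derivative of the
  logarithm of the quotient has the sign given by the Pade bound.\<close>

lemma expm1_le_gauss:
  fixes z :: real
  assumes "0 < z"
  shows "exp z - 1 \<le> z * exp (z / 2 + z\<^sup>2 / 24)"
proof -
  have "0 \<le> ln z + z / 2 + z\<^sup>2 / 24 - ln (exp z - 1)"
  proof (rule nonneg_of_deriv_nonneg_at_right[where f = "\<lambda>z. ln z + z / 2 + z\<^sup>2 / 24 - ln (exp z - 1)"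
        and f' = "\<lambda>z. 1 / z + 1 / 2 + z / 12 - exp z / (exp z - 1)"])
    show "((\<lambda>z::real. ln z + z / 2 + z\<^sup>2 / 24 - ln (exp z - 1)) \<longlongrightarrow> 0) (at_right 0)"
      by real_asymp
    fix x :: real assume x: "0 < x"
    then show "((\<lambda>z. ln z + z / 2 + z\<^sup>2 / 24 - ln (exp z - 1)) has_real_derivative
        1 / x + 1 / 2 + x / 12 - exp x / (exp x - 1)) (at x)"
      by (auto intro!: derivative_eq_intros simp: field_simps)
    have "exp x - 1 > 0" using x by simp
    then have "1 / x + 1 / 2 + x / 12 - exp x / (exp x - 1) =
        ((exp x - 1) * (12 - 6 * x + x\<^sup>2) - 12 * x) / (12 * x * (exp x - 1))"
      using x by (simp add: field_simps power2_eq_square)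
    then show "0 \<le> 1 / x + 1 / 2 + x / 12 - exp x / (exp x - 1)"
      using expm1_pade_lower[of x] x by simp
  qed (use assms in simp)
  then have "ln (exp z - 1) \<le> ln z + (z / 2 + z\<^sup>2 / 24)" by simp
  then have "exp (ln (exp z - 1)) \<le> exp (ln z + (z / 2 + z\<^sup>2 / 24))" by simp
  then show ?thesis using assms by (simp add: exp_add)
qed

text \<open>The matching lower bound on \<open>sinh u / u\<close>, from
  \<open>1 - exp (- z) = 2 exp (- z / 2) sinh (z / 2)\<close>. The term \<open>z^3 / 540\<close> is
  the integral of \<open>z^2 / 180\<close>, the slack left by
  \<open>expm1_cubic_upper\<close>.\<close>

lemma one_minus_exp_ge_gauss:
  fixes z :: real
  assumes "0 < z"
  shows "z * exp (- z / 2 + z\<^sup>2 / 24 - z ^ 3 / 540) \<le> 1 - exp (- z)"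
proof -
  have "0 \<le> ln (1 - exp (- z)) - ln z + z / 2 - z\<^sup>2 / 24 + z ^ 3 / 540"
  proof (rule nonneg_of_deriv_nonneg_at_right[where f = "\<lambda>z. ln (1 - exp (- z)) - ln z + z / 2 - z\<^sup>2 / 24 + z ^ 3 / 540"
        and f' = "\<lambda>z. exp (- z) / (1 - exp (- z)) - 1 / z + 1 / 2 - z / 12 + z\<^sup>2 / 180"])
    show "((\<lambda>z::real. ln (1 - exp (- z)) - ln z + z / 2 - z\<^sup>2 / 24 + z ^ 3 / 540) \<longlongrightarrow> 0) (at_right 0)"
      by real_asymp
    fix x :: real assume x: "0 < x"
    then show "((\<lambda>z. ln (1 - exp (- z)) - ln z + z / 2 - z\<^sup>2 / 24 + z ^ 3 / 540) has_real_derivative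
        exp (- x) / (1 - exp (- x)) - 1 / x + 1 / 2 - x / 12 + x\<^sup>2 / 180) (at x)"
      by (auto intro!: derivative_eq_intros simp: field_simps)
    have p: "exp x - 1 > 0" using x by simp
    have "exp (- x) / (1 - exp (- x)) = 1 / (exp x - 1)"
      using p by (simp add: exp_minus field_simps)
    then have "exp (- x) / (1 - exp (- x)) - 1 / x + 1 / 2 - x / 12 + x\<^sup>2 / 180 =
        (180 * x - (exp x - 1) * (180 - 90 * x + 15 * x\<^sup>2 - x ^ 3)) / (180 * x * (exp x - 1))"
      using x p by (simp add: field_simps power2_eq_square power3_eq_cube)
    then show "0 \<le> exp (- x) / (1 - exp (- x)) - 1 / x + 1 / 2 - x / 12 + x\<^sup>2 / 180"
      using expm1_cubic_upper[of x] x by simp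
  qed (use assms in simp)
  then have "ln z + (- z / 2 + z\<^sup>2 / 24 - z ^ 3 / 540) \<le> ln (1 - exp (- z))" by simp
  then have "exp (ln z + (- z / 2 + z\<^sup>2 / 24 - z ^ 3 / 540)) \<le> exp (ln (1 - exp (- z)))"
    by (rule iffD2[OF exp_le_cancel_iff])
  then show ?thesis using assms by (simp add: exp_add)
qed

text \<open>
  In terms of \<open>A = 1 + (1 + N) (\<rho> + s)\<close> and \<open>B = 1 - (1 + m) (\<rho> + s)\<close>, the case \<open>s = 0\<close> is the
  arithmetic-geometric mean inequality for the three numbers A, B and \<open>m A + N B\<close>, whose sum is 3.
\<close>

lemma drift_polynomial_le_one:
  fixes N m \<rho> s :: real
  assumes N: "0 \<le> N" "0 \<le> m" "N + m = 1" and s: "0 \<le> s"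
    and a: "0 < 1 + (1 + N) * \<rho>" and B: "0 < 1 - (1 + m) * (\<rho> + s)"
  shows "(1 + (1 + N) * (\<rho> + s)) * (1 - (1 + m) * (\<rho> + s)) *
    (m * (1 + (1 + N) * \<rho>) + N * (1 - (1 + m) * \<rho>)
     + s * ((m * (1 + (1 + N) * \<rho>))\<^sup>2 - (N * (1 - (1 + m) * \<rho>))\<^sup>2)
     + 2/5 * (N * (1 - (1 + m) * \<rho>)) ^ 3 * s\<^sup>2) \<le> 1"
proof -
  define \<mu> where "\<mu> = m - N"
  define \<sigma> where "\<sigma> = \<rho> + s"
  define L where "L = \<mu> * (3 - \<mu>\<^sup>2) / 2"
  define K where "K = 3 / 2 + \<mu>\<^sup>2 / 2 + L * \<rho>"
  define f where "f = 2/5 * (N * (1 - (1 + m) * \<rho>)) ^ 3"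
  define H where "H = \<rho> * s * K + f * s\<^sup>2"
  define AB where "AB = (1 + (1 + N) * \<sigma>) * (1 - (1 + m) * \<sigma>)"
  define y where "y = (9 - \<mu>\<^sup>2) / 4"
  define M where "M = \<mu>\<^sup>2 + y * (1 + \<mu> * \<sigma>)"
  have Neq: "N = (1 - \<mu>) / 2" "m = (1 + \<mu>) / 2" using N \<mu>_def by auto
  have \<mu>: "-1 \<le> \<mu>" "\<mu> \<le> 1" using N by (auto simp: Neq)
  have \<mu>2: "0 \<le> \<mu>\<^sup>2" "\<mu>\<^sup>2 \<le> 1" using \<mu> by (auto simp: abs_square_le_1 abs_le_iff)
  have ABeq: "AB = 1 - \<mu> * \<sigma> - y * \<sigma>\<^sup>2"
    unfolding AB_def y_def Neq by (simp add: field_simps power2_eq_square)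
  have J: "m * (1 + (1 + N) * \<rho>) + N * (1 - (1 + m) * \<rho>)
     + s * ((m * (1 + (1 + N) * \<rho>))\<^sup>2 - (N * (1 - (1 + m) * \<rho>))\<^sup>2) = 1 + \<mu> * \<sigma> + \<rho> * s * K"
    unfolding K_def L_def \<sigma>_def Neq by (simp add: field_simps power2_eq_square power3_eq_cube)
  \<comment> \<open>\<open>H\<close> is what the long factor has beyond
    \<open>1 + \<mu> \<sigma>\<close>. As \<open>AB (1 + \<mu> \<sigma>) = 1 - \<sigma>^2 M\<close>,
    the claim reduces to \<open>AB H \<le> \<sigma>^2 M\<close>.\<close>
  have key: "AB * (1 + \<mu> * \<sigma> + H) = 1 - (\<sigma>\<^sup>2 * M - AB * H)"
    unfolding ABeq M_def by (simp add: field_simps power2_eq_square)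
  have A0: "0 < 1 + (1 + N) * \<sigma>"
    using a mult_nonneg_nonneg[of "1 + N" s] s N unfolding \<sigma>_def distrib_left by linarith
  have AB0: "0 < AB" unfolding AB_def using A0 B \<sigma>_def by simp
  have b0: "0 < 1 - (1 + m) * \<rho>" 
    using B mult_nonneg_nonneg[of "1 + m" s] s N unfolding distrib_left by linarith
  have f0: "0 \<le> f" unfolding f_def using b0 N by simp
  \<comment> \<open>The reduced claim is split by the constant 156/100 into
    \<open>H \<le> 1.56 \<sigma>^2\<close> and \<open>1.56 AB \<le> M\<close>. The second difference
    is a quadratic in \<open>\<sigma>\<close> whose discriminant is nonpositive for every
    \<open>\<mu>\<close> in [-1, 1].\<close>
  have disc: "156/100 * AB \<le> M"
  proof -
    have "M - 156/100 * AB = (\<mu>\<^sup>2 + y - 156/100) + \<mu> * \<sigma> * (y + 156/100) + 156/100 * y * \<sigma>\<^sup>2"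
      unfolding M_def ABeq by (simp add: field_simps)
    moreover have "0 \<le> \<dots>"
    proof -
      have y: "2 \<le> y" "y \<le> 9/4" unfolding y_def using \<mu>2 by auto
      have *: "\<mu>\<^sup>2 * (y + 156/100)\<^sup>2 \<le> 4 * (156/100 * y) * (\<mu>\<^sup>2 + y - 156/100)"
      proof -
        have "4 * (156/100 * y) * (\<mu>\<^sup>2 + y - 156/100) \<ge> 4 * (156/100 * y) * (\<mu>\<^sup>2 + 44/100)"
          using y by (intro mult_left_mono) auto
        also have "4 * (156/100 * y) * (\<mu>\<^sup>2 + 44/100) \<ge> 12 * (\<mu>\<^sup>2 * (144/100))"
          using y \<mu>2 by (intro mult_mono) auto
        finally have "4 * (156/100 * y) * (\<mu>\<^sup>2 + y - 156/100) \<ge> \<mu>\<^sup>2 * (1728/100)" by simp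
        moreover have "(y + 156/100)\<^sup>2 \<le> (9/4 + 156/100)\<^sup>2" using y by (intro power_mono) auto
        then have "(y + 156/100)\<^sup>2 \<le> 1728/100" by (simp add: power2_eq_square)
        then have "\<mu>\<^sup>2 * (y + 156/100)\<^sup>2 \<le> \<mu>\<^sup>2 * (1728/100)" using \<mu>2 by (intro mult_left_mono) auto
        ultimately show ?thesis by linarith
      qed
      define p q r where "p = 156/100 * y" and "q = \<mu> * (y + 156/100)" and "r = \<mu>\<^sup>2 + y - 156/100"
      have "q\<^sup>2 \<le> 4 * p * r" using * by (simp add: p_def q_def r_def power_mult_distrib)
      moreover have "0 < p" using y by (simp add: p_def)
      moreover have "4 * p * (r + q * \<sigma> + p * \<sigma>\<^sup>2) = (2 * p * \<sigma> + q)\<^sup>2 + (4 * p * r - q\<^sup>2)"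
        by (simp add: algebra_simps power2_eq_square)
      ultimately have "0 \<le> 4 * p * (r + q * \<sigma> + p * \<sigma>\<^sup>2)" by simp
      with \<open>0 < p\<close> have "0 \<le> r + q * \<sigma> + p * \<sigma>\<^sup>2" by (simp add: zero_le_mult_iff)
      then show ?thesis by (simp add: p_def q_def r_def algebra_simps)
    qed
    ultimately show ?thesis by linarith
  qed
  have "H \<le> 156/100 * \<sigma>\<^sup>2"
  proof (cases "0 \<le> \<rho>")
    case True
    have \<rho>1: "\<rho> \<le> 1" using b0 mult_right_mono[of 1 "1 + m" \<rho>] True N by linarith
    have "L \<le> 1"
    proof -
      have "0 \<le> (1 - \<mu>)\<^sup>2 * (\<mu> + 2)" using \<mu> by simp
      then show ?thesis unfolding L_def by (simp add: field_simps power2_eq_square)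
    qed
    then have "L * \<rho> \<le> 1 * \<rho>" using True by (rule mult_right_mono)
    then have "L * \<rho> \<le> 1" using \<rho>1 by simp
    moreover have "3 / 2 + \<mu>\<^sup>2 / 2 \<le> 2" using \<mu>2 by simp
    ultimately have K: "K \<le> 3" unfolding K_def by linarith
    have "N * (1 - (1 + m) * \<rho>) \<le> 1 * 1" using N True b0 by (intro mult_mono) auto
    then have "(N * (1 - (1 + m) * \<rho>)) ^ 3 \<le> 1 ^ 3" using N b0 by (intro power_mono) auto
    then have f: "f \<le> 2/5" unfolding f_def by simp
    have "H \<le> \<rho> * s * 3 + 2/5 * s\<^sup>2"
      unfolding H_def using True s K f by (intro add_mono mult_left_mono mult_right_mono) auto
    also have "\<dots> = 156/100 * \<sigma>\<^sup>2 - (156/100 * \<rho>\<^sup>2 + 12/100 * (\<rho> * s) + 116/100 * s\<^sup>2)"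
      unfolding \<sigma>_def by (simp add: field_simps power2_eq_square)
    also have "\<dots> \<le> 156/100 * \<sigma>\<^sup>2"
      using zero_le_power2[of \<rho>] mult_nonneg_nonneg[OF True s] zero_le_power2[of s] by linarith
    finally show ?thesis .
  next
    case False
    \<comment> \<open>With \<open>s = \<sigma> + r\<close>, \<open>H\<close> becomes a quadratic
      form in \<open>\<sigma>\<close> and \<open>r\<close>; the factored version \<open>H'\<close>
      settles the sign when \<open>\<sigma>\<close> is negative.\<close>
    define r where "r = - \<rho>"
    have r: "0 < r" using False r_def by simp
    have H: "H = f * \<sigma>\<^sup>2 + \<sigma> * r * (2 * f - K) - r\<^sup>2 * (K - f)"
      and H': "H = s * (f * \<sigma> - r * (K - f))"
      unfolding H_def r_def \<sigma>_def by (simp_all add: algebra_simps power2_eq_square)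
    have rN: "(1 + N) * r \<le> 1" using a by (simp add: r_def)
    have b3: "(1 - (1 + m) * \<rho>) * (1 + N) \<le> 3"
    proof -
      have "(1 - (1 + m) * \<rho>) * (1 + N) = 1 + N + (1 + m) * ((1 + N) * r)"
        by (simp add: r_def algebra_simps)
      also have "\<dots> \<le> 1 + N + (1 + m) * 1" using rN N by (intro add_mono mult_left_mono) auto
      finally show ?thesis using N by simp
    qed
    define \<beta> where "\<beta> = N * (1 - (1 + m) * \<rho>)"
    have \<beta>0: "0 \<le> \<beta>" unfolding \<beta>_def using N b0 by simp
    have \<beta>: "\<beta> * (1 + N) \<le> 3 * N" unfolding \<beta>_def using mult_left_mono[OF b3 N(1)] by (simp add: algebra_simps)
    show ?thesis
    proof (cases "\<mu> \<le> 0")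
      case True
      \<comment> \<open>Bounding \<open>N / (1 + N)\<close> by the linear \<open>(1 + N) / 4\<close>
        makes the cube of \<open>\<beta>\<close> a polynomial in \<open>m\<close>.\<close>
      have "\<beta> * (1 + N) \<le> 3 * (2 - m) / 4 * (1 + N)"
      proof -
        have "2 - m = 1 + N" using N by simp
        then have "3 * (2 - m) / 4 * (1 + N) = 3 / 4 * (1 + N)\<^sup>2" by (simp add: power2_eq_square)
        moreover have "4 * N \<le> (1 + N)\<^sup>2" using zero_le_power2[of "1 - N"] by (simp add: power2_eq_square algebra_simps)
        ultimately show ?thesis using \<beta> by linarith
      qed
      then have "\<beta> \<le> 3 * (2 - m) / 4" using N by (simp add: mult_le_cancel_right)
      then have "\<beta> ^ 3 \<le> (3 * (2 - m) / 4) ^ 3" using \<beta>0 by (rule power_mono)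
      also have "(3 * (2 - m) / 4) ^ 3 = 27/8 - 81/16 * m + 81/32 * m\<^sup>2 - 27/64 * m ^ 3"
        by (simp add: power2_eq_square power3_eq_cube field_simps)
      finally have f': "f \<le> 27/20 - 81/40 * m + 81/80 * m\<^sup>2 - 27/160 * m ^ 3"
        unfolding f_def \<beta>_def[symmetric] by linarith
      have "0 \<le> \<mu> * \<rho> * (3 - \<mu>\<^sup>2) / 2" using True False \<mu>2 by (simp add: zero_le_mult_iff)
      then have "0 \<le> L * \<rho>" unfolding L_def by (simp add: mult.commute mult.left_commute)
      then have "3 / 2 + \<mu>\<^sup>2 / 2 \<le> K" unfolding K_def by simp
      moreover have "\<mu>\<^sup>2 = 4 * m\<^sup>2 - 4 * m + 1" unfolding Neq by (simp add: power2_eq_square field_simps)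
      ultimately have K: "2 + 2 * m\<^sup>2 - 2 * m \<le> K" by linarith
      have m3: "0 \<le> m" "0 \<le> m\<^sup>2" "0 \<le> m ^ 3" "m\<^sup>2 \<le> m" using N by (auto simp: power2_eq_square mult_left_le)
      have f1: "f \<le> 135/100" using f' K m3 by linarith
      have f2: "6/10 \<le> K - f" using f' K m3 by linarith
      have f3: "2 * f - K \<le> 7/10" using f' K m3 by linarith
      show ?thesis
      proof (cases "0 \<le> \<sigma>")
        case True
        \<comment> \<open>The tightest case for the constant: over \<open>r\<close> the maximum, at
          \<open>r = 7/12 \<sigma>\<close>, is about \<open>1.554 \<sigma>^2\<close>, just below
          156/100.\<close>
        have "H \<le> 135/100 * \<sigma>\<^sup>2 + \<sigma> * r * (7/10) - r\<^sup>2 * (6/10)"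
          unfolding H using f1 f2 f3 True r
          by (intro diff_mono add_mono mult_left_mono mult_right_mono) auto
        also have "\<dots> = 156/100 * \<sigma>\<^sup>2 - (6/10 * (r - 7/12 * \<sigma>)\<^sup>2 + 7/1200 * \<sigma>\<^sup>2)"
          by (simp add: field_simps power2_eq_square)
        also have "\<dots> \<le> 156/100 * \<sigma>\<^sup>2"
          using zero_le_power2[of "r - 7/12 * \<sigma>"] zero_le_power2[of \<sigma>] by linarith
        finally show ?thesis .
      next
        case False
        have "f * \<sigma> \<le> 0" using False f0 by (simp add: mult_nonneg_nonpos)
        moreover have "0 \<le> r * (K - f)" using r f2 by simp
        ultimately have "H \<le> 0" unfolding H' using s by (simp add: mult_nonneg_nonpos)
        then show ?thesis using zero_le_power2[of \<sigma>] by linarith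
      qed
    next
      case \<mu>p: False
      have "2 * N \<le> 1" using \<mu>p N unfolding \<mu>_def by simp
      then have "\<beta> * (1 + N) \<le> 1 + N" using \<beta> by linarith
      then have "\<beta> \<le> 1" using N mult_le_cancel_right[of \<beta> "1 + N" 1] by simp
      then have "\<beta> ^ 3 \<le> 1 ^ 3" using \<beta>0 by (rule power_mono)
      then have f1: "f \<le> 2/5" unfolding f_def \<beta>_def[symmetric] by simp
      have r1: "r \<le> 1" using rN mult_right_mono[of 1 "1 + N" r] N r by linarith
      have "0 \<le> L" unfolding L_def using \<mu>p \<mu>2 by simp
      then have "L * r \<le> L * 1" using r1 by (rule mult_left_mono[rotated])
      then have "3 / 2 + \<mu>\<^sup>2 / 2 - L \<le> K" unfolding K_def r_def by simp
      \<comment> \<open>The cubic \<open>3/2 + \<mu>^2 / 2 - L\<close> has its minimum on [0, 1]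
        near 0.72, with value above 0.86; the two nonnegative terms certify 8/10. That is twice the
        bound 2/5 on \<open>f\<close>, so \<open>2 f - K\<close> and \<open>f - K\<close> are both
        nonpositive.\<close>
      moreover have "0 \<le> (\<mu> - 72/100)\<^sup>2 * (\<mu> + 144/100)" using \<mu>p by simp
      moreover have "0 \<le> (\<mu> - 7224/10000)\<^sup>2" by simp
      moreover have "3 / 2 + \<mu>\<^sup>2 / 2 - L - 8/10 = 1/2 * ((\<mu> - 72/100)\<^sup>2 * (\<mu> + 144/100))
          + 1/2 * (\<mu> - 7224/10000)\<^sup>2 + 6582112/100000000"
        unfolding L_def by (simp add: field_simps power2_eq_square)
      ultimately have K: "8/10 \<le> K" by linarith
      show ?thesis
      proof (cases "0 \<le> \<sigma>")
        case True
        have "H \<le> 2/5 * \<sigma>\<^sup>2 + \<sigma> * r * 0 - r\<^sup>2 * 0"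
          unfolding H using f1 K True r
          by (intro diff_mono add_mono mult_left_mono mult_right_mono) auto
        then show ?thesis using zero_le_power2[of \<sigma>] by linarith
      next
        case False
        have "f * \<sigma> \<le> 0" using False f0 by (simp add: mult_nonneg_nonpos)
        moreover have "0 \<le> r * (K - f)" using r f1 K by simp
        ultimately have "H \<le> 0" unfolding H' using s by (simp add: mult_nonneg_nonpos)
        then show ?thesis using zero_le_power2[of \<sigma>] by linarith
      qed
    qed
  qed
  then have "AB * H \<le> AB * (156/100 * \<sigma>\<^sup>2)" using AB0 by (intro mult_left_mono) auto
  also have "\<dots> \<le> \<sigma>\<^sup>2 * M" using mult_right_mono[OF disc, of "\<sigma>\<^sup>2"] by (simp add: algebra_simps)
  finally have "AB * (1 + \<mu> * \<sigma> + H) \<le> 1" unfolding key by simp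
  then show ?thesis unfolding J[symmetric] H_def AB_def \<sigma>_def f_def J by (simp add: algebra_simps)
qed

section \<open>A supersolution of the urn recursion\<close>

text \<open>The shifts \<open>a\<close> and \<open>b\<close> of \<open>A\<close> and
  \<open>B\<close> make the exponents the products \<open>2 c m a\<close> and
  \<open>2 c N b\<close>. The two bounds above replace \<open>exp z2 - 1\<close> and
  \<open>1 - exp (- z1)\<close> by \<open>z2\<close> and \<open>z1\<close> times exponentials of
  polynomials, which leaves the comparison of \<open>B a exp X\<close> with \<open>A b\<close>, made
  on the logarithmic scale.\<close>

lemma drift_inequality_normalised:
  fixes N m A B c :: real
  assumes N: "0 < N" "0 < m" "N + m = 1" and c: "0 < c" and A: "0 \<le> A" and B: "0 < B"
    and W: "(1 + m) * A + (1 + N) * B = 3"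
  shows "N * B * (exp (2 * c * m * (A - (1 + N) * c / 3)) - 1)
    \<le> m * A * (1 - exp (- (2 * c * N * (B + (1 + m) * c / 3))))"
proof -
  define a where "a = A - (1 + N) * c / 3"
  define b where "b = B + (1 + m) * c / 3"
  define z1 where "z1 = 2 * c * N * b"
  define z2 where "z2 = 2 * c * m * a"
  have b0: "0 < b" unfolding b_def using B N c by (simp add: add_pos_nonneg)
  have z1: "0 < z1" unfolding z1_def using b0 c N by simp
  have "N * B * (exp z2 - 1) \<le> m * A * (1 - exp (- z1))"
  proof (cases "a \<le> 0")
    case True
    then have "z2 \<le> 0" unfolding z2_def using c N by (simp add: mult_nonneg_nonpos)
    then have "N * B * (exp z2 - 1) \<le> 0" using N B by (simp add: mult_nonneg_nonpos)
    also have "0 \<le> m * A * (1 - exp (- z1))" using z1 N A by simp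
    finally show ?thesis .
  next
    case False
    then have a0: "0 < a" by simp
    have z2: "0 < z2" unfolding z2_def using a0 c N by simp
    have A0: "0 < A" using a0 c N unfolding a_def by (smt (verit) divide_nonneg_nonneg mult_nonneg_nonneg)
    have ab: "(1 + m) * a + (1 + N) * b = 3" using W unfolding a_def b_def by (simp add: algebra_simps)
    \<comment> \<open>The normalisation leaves one degree of freedom: \<open>\<rho>\<close> measures
      the deviation from the balanced point \<open>a = b = 1\<close>.\<close>
    define \<rho> where "\<rho> = (a - 1) / (1 + N)"
    have a\<rho>: "a = 1 + (1 + N) * \<rho>" unfolding \<rho>_def using N by simp
    have b\<rho>: "b = 1 - (1 + m) * \<rho>"
    proof -
      have "(1 + N) * (1 - (1 + m) * \<rho>) = (1 + N) - (1 + m) * (a - 1)"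
        unfolding \<rho>_def using N by (simp add: field_simps)
      also have "\<dots> = (1 + N) * b" using ab N by (simp add: algebra_simps)
      finally show ?thesis using N by simp
    qed
    define F where "F t = ln (a + (1 + N) * t / 3) - ln (b - (1 + m) * t / 3)
      - (t * (m * a + N * b) + t\<^sup>2 / 6 * ((m * a)\<^sup>2 - (N * b)\<^sup>2) + 2 / 135 * (N * b) ^ 3 * t ^ 3)" for t
    \<comment> \<open>Keep a and b fixed and let c grow from 0: both sides agree at \<open>t = 0\<close>, and the derivative
      has the sign of \<open>1 - At * Bt * J\<close>.\<close>
    have "F 0 \<le> F c"
    proof (rule DERIV_nonneg_imp_nondecreasing[where f = F and a = 0 and b = c])
      show "0 \<le> c" using c by simp
      fix t assume t: "0 \<le> t" "t \<le> c"
      define At where "At = a + (1 + N) * t / 3"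
      define Bt where "Bt = b - (1 + m) * t / 3"
      define J where "J = m * a + N * b + t / 3 * ((m * a)\<^sup>2 - (N * b)\<^sup>2) + 2/5 * (N * b) ^ 3 * (t / 3)\<^sup>2"
      have At: "0 < At" unfolding At_def using a0 t N by (simp add: add_pos_nonneg)
      have "(1 + m) * t \<le> (1 + m) * c" using t N by simp
      then have Bt: "0 < Bt" unfolding Bt_def b_def using B by linarith
      have "((\<lambda>t. ln (a + (1 + N) * t / 3)) has_real_derivative (1 + N) / 3 / At) (at t)"
        using At unfolding At_def by (auto intro!: derivative_eq_intros simp: field_simps)
      moreover have "((\<lambda>t. ln (b - (1 + m) * t / 3)) has_real_derivative - ((1 + m) / 3 / Bt)) (at t)"
        using Bt unfolding Bt_def by (auto intro!: derivative_eq_intros simp: field_simps)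
      moreover have "((\<lambda>t. t * U + t\<^sup>2 / 6 * V + 2 / 135 * K * t ^ 3) has_real_derivative
          U + t / 3 * V + 2/5 * K * (t / 3)\<^sup>2) (at t)" for U V K
        by (auto intro!: derivative_eq_intros simp: field_simps power2_eq_square)
      ultimately have "(F has_real_derivative (1 + N) / 3 / At - - ((1 + m) / 3 / Bt) - J) (at t)"
        unfolding F_def J_def by (intro DERIV_diff)
      then have "(F has_real_derivative (1 + N) / 3 / At + (1 + m) / 3 / Bt - J) (at t)" by simp
      moreover have "(1 + N) / 3 / At + (1 + m) / 3 / Bt = ((1 + N) * Bt + (1 + m) * At) / (3 * (At * Bt))"
        using At Bt by (simp add: field_simps)
      moreover have "(1 + N) * Bt + (1 + m) * At = 3"
        unfolding At_def Bt_def using ab by (simp add: field_simps)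
      moreover have "At * Bt * J \<le> 1"
      proof -
        have At': "At = 1 + (1 + N) * (\<rho> + t / 3)" unfolding At_def a\<rho> by (simp add: algebra_simps)
        have Bt': "Bt = 1 - (1 + m) * (\<rho> + t / 3)" unfolding Bt_def b\<rho> by (simp add: field_simps)
        show ?thesis
          unfolding At' Bt' J_def a\<rho> b\<rho> using drift_polynomial_le_one[of N m "t / 3" \<rho>] N t a0 Bt
          unfolding a\<rho> Bt' by simp
      qed
      then have "J \<le> 1 / (At * Bt)" using At Bt by (simp add: field_simps)
      ultimately show "\<exists>y. (F has_real_derivative y) (at t) \<and> 0 \<le> y" by auto
    qed
    moreover have "F 0 = ln a - ln b" unfolding F_def by simp
    moreover have Ac: "a + (1 + N) * c / 3 = A" "b - (1 + m) * c / 3 = B"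
      unfolding a_def b_def by simp_all
    define X where "X = c * (m * a + N * b) + c\<^sup>2 / 6 * ((m * a)\<^sup>2 - (N * b)\<^sup>2) + 2 / 135 * (N * b) ^ 3 * c ^ 3"
    have "F c = ln A - ln B - X" unfolding F_def Ac X_def ..
    ultimately have "ln B + ln a + X \<le> ln A + ln b" by simp
    then have "exp (ln B + ln a + X) \<le> exp (ln A + ln b)" by simp
    then have main: "B * a * exp X \<le> A * b" using A0 B a0 b0 by (simp add: exp_add)
    define Y where "Y = - z1 / 2 + z1\<^sup>2 / 24 - z1 ^ 3 / 540"
    have XY: "z2 / 2 + z2\<^sup>2 / 24 = X + Y"
      unfolding X_def Y_def z1_def z2_def by (simp add: field_simps power2_eq_square power3_eq_cube)
    have "N * B * (exp z2 - 1) \<le> N * B * (z2 * exp (z2 / 2 + z2\<^sup>2 / 24))"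
      using expm1_le_gauss[OF z2] N B by (intro mult_left_mono) auto
    also have "\<dots> = 2 * c * N * m * exp Y * (B * a * exp X)"
      unfolding XY exp_add by (simp add: z2_def)
    also have "\<dots> \<le> 2 * c * N * m * exp Y * (A * b)"
      using main c N by (intro mult_left_mono) auto
    also have "\<dots> = m * A * (z1 * exp Y)" unfolding z1_def by (simp add: algebra_simps)
    also have "\<dots> \<le> m * A * (1 - exp (- z1))"
      using one_minus_exp_ge_gauss[OF z1] N A unfolding Y_def by (intro mult_left_mono) auto
    finally show ?thesis .
  qed
  then show ?thesis unfolding z1_def z2_def a_def b_def .
qed

text \<open>The exponents are homogeneous of degree 0 in \<open>(N, m)\<close> and in
  \<open>(A, B, c)\<close>, and the prefactors on both sides scale alike. Hence
  \<open>N + m = 1\<close> and \<open>W = 3\<close> may be assumed.\<close>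

lemma drift_inequality:
  fixes N m A B c :: real
  assumes N: "0 < N" "0 < m" and c: "0 < c" and A: "0 \<le> A" and B: "0 < B"
  defines "W \<equiv> (N + 2 * m) * A + (2 * N + m) * B"
  shows "N * B * (exp (6 * c * m * (3 * (N + m) * A - (2 * N + m) * c) / W\<^sup>2) - 1)
    \<le> m * A * (1 - exp (- (6 * c * N * ((N + 2 * m) * c + 3 * (N + m) * B) / W\<^sup>2)))"
proof -
  define S where "S = N + m"
  define \<eta> where "\<eta> = 3 * S / W"
  have S: "0 < S" unfolding S_def using N by simp
  have W: "0 < W" unfolding W_def using N A B by (simp add: add_nonneg_pos)
  have \<eta>: "0 < \<eta>" unfolding \<eta>_def using S W by simp
  have e: "1 + m / S = (N + 2 * m) / S" "1 + N / S = (2 * N + m) / S"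
    using S unfolding S_def by (simp_all add: field_simps)
  have 1: "(1 + m / S) * (\<eta> * A) + (1 + N / S) * (\<eta> * B) = 3"
  proof -
    have "(1 + m / S) * (\<eta> * A) + (1 + N / S) * (\<eta> * B) = \<eta> / S * W"
      unfolding e W_def by (simp add: field_simps add_divide_distrib)
    then show ?thesis unfolding \<eta>_def using S W by simp
  qed
  have "N / S + m / S = 1" using S unfolding S_def by (simp add: add_divide_distrib[symmetric])
  then have *: "N / S * (\<eta> * B) * (exp (2 * (\<eta> * c) * (m / S) * (\<eta> * A - (1 + N / S) * (\<eta> * c) / 3)) - 1)
    \<le> m / S * (\<eta> * A) * (1 - exp (- (2 * (\<eta> * c) * (N / S) * (\<eta> * B + (1 + m / S) * (\<eta> * c) / 3))))"
    using N S \<eta> c A B 1 by (intro drift_inequality_normalised) auto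
  have z2: "2 * (\<eta> * c) * (m / S) * (\<eta> * A - (1 + N / S) * (\<eta> * c) / 3)
    = 6 * c * m * (3 * (N + m) * A - (2 * N + m) * c) / W\<^sup>2"
    unfolding e S_def[symmetric] \<eta>_def using S W by (simp add: field_simps power2_eq_square)
  have z1: "2 * (\<eta> * c) * (N / S) * (\<eta> * B + (1 + m / S) * (\<eta> * c) / 3)
    = 6 * c * N * ((N + 2 * m) * c + 3 * (N + m) * B) / W\<^sup>2"
    unfolding e S_def[symmetric] \<eta>_def using S W by (simp add: field_simps power2_eq_square)
  define E1 where "E1 = 1 - exp (- (6 * c * N * ((N + 2 * m) * c + 3 * (N + m) * B) / W\<^sup>2))"
  define E2 where "E2 = exp (6 * c * m * (3 * (N + m) * A - (2 * N + m) * c) / W\<^sup>2) - 1"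
  have "\<eta> / S * (N * B * E2) \<le> \<eta> / S * (m * A * E1)"
    using * unfolding z1 z2 E1_def[symmetric] E2_def[symmetric] by (simp add: algebra_simps)
  then have "N * B * E2 \<le> m * A * E1" using \<eta> S by (simp add: mult_le_cancel_left_pos divide_right_mono field_simps)
  then show ?thesis unfolding E1_def E2_def .
qed

text \<open>
  The argument \<open>y + 1\<close>, rather than y, reflects the \<open>+ 1\<close> in the conformal p-value. It also pays for
  the discreteness of the steps in the y-direction.
\<close>

definition barrier_exponent :: "real \<Rightarrow> real \<Rightarrow> real \<Rightarrow> real \<Rightarrow> real \<Rightarrow> real" where
  "barrier_exponent N m c x y =
     6 * c * (c + m * (y + 1) - N * x) / ((N + 2 * m) * N * x + (2 * N + m) * m * (y + 1))"

text \<open>Relative to the value at \<open>(x, y)\<close>, a step in x multiplies by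
  \<open>exp (- z1)\<close> and a step in y by \<open>exp z2\<close>. The weighted loss of the first
  must outweigh the weighted gain of the second, which is what \<open>drift_inequality\<close>
  provides.\<close>

lemma barrier_supersolution:
  fixes N m c :: real and x y :: nat
  assumes N: "0 < N" "0 < m" and c: "0 < c"
  shows "real x * exp (- barrier_exponent N m c (real x - 1) (real y))
       + real y * exp (- barrier_exponent N m c (real x) (real y - 1))
     \<le> (real x + real y) * exp (- barrier_exponent N m c (real x) (real y))"
proof -
  define P Q S where "P = N + 2 * m" and "Q = 2 * N + m" and "S = N + m"
  have pos: "0 < P" "0 < Q" "0 < S" using N by (auto simp: P_def Q_def S_def)
  define W where "W = P * N * x + Q * m * (real y + 1)"
  define z1 where "z1 = 6 * c * N * (P * c + 3 * S * m * (real y + 1)) / (W * (W - P * N))"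
  define z2 where "z2 = 6 * c * m * (3 * S * N * x - Q * c) / (W * (W - Q * m))"
  have W: "0 < W" unfolding W_def using N pos by (simp add: add_nonneg_pos)
  \<comment> \<open>At \<open>x = 0\<close> the predecessor \<open>x - 1\<close> is -1, a state
    entering with weight 0, so nothing is needed about its denominator.\<close>
  have s1: "0 < W - P * N \<and> barrier_exponent N m c (real x - 1) y = barrier_exponent N m c x y + z1" if "x > 0"
  proof -
    have "W - P * N = P * N * (real x - 1) + Q * m * (real y + 1)" unfolding W_def by (simp add: algebra_simps)
    also have "0 < \<dots>" using N pos that by (intro add_nonneg_pos) auto
    finally have W1: "0 < W - P * N" .
    have "barrier_exponent N m c (real x - 1) y = 6 * c * (c + m * (real y + 1) - N * x + N) / (W - P * N)"
      unfolding barrier_exponent_def W_def P_def Q_def by (simp add: algebra_simps)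
    moreover have "barrier_exponent N m c x y = 6 * c * (c + m * (real y + 1) - N * x) / W"
      unfolding barrier_exponent_def W_def P_def Q_def by simp
    moreover have "6 * c * (c + m * (real y + 1) - N * x + N) / (W - P * N) - 6 * c * (c + m * (real y + 1) - N * x) / W
      = 6 * c * (N * W + P * N * (c + m * (real y + 1) - N * x)) / (W * (W - P * N))"
      using W W1 by (simp add: divide_simps) (simp add: algebra_simps)
    moreover have "N * W + P * N * (c + m * (real y + 1) - N * x) = N * (P * c + 3 * S * m * (real y + 1))"
      unfolding W_def P_def Q_def S_def by (simp add: algebra_simps)
    ultimately show ?thesis using W1 unfolding z1_def mult.assoc by simp
  qed
  have s2: "0 < W - Q * m \<and> barrier_exponent N m c x (real y - 1) = barrier_exponent N m c x y - z2" if "y > 0"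
  proof -
    have "W - Q * m = P * N * x + Q * m * y" unfolding W_def by (simp add: algebra_simps)
    also have "0 < \<dots>" using N pos that by (intro add_nonneg_pos) auto
    finally have W1: "0 < W - Q * m" .
    have "barrier_exponent N m c x (real y - 1) = 6 * c * (c + m * (real y + 1) - N * x - m) / (W - Q * m)"
      unfolding barrier_exponent_def W_def P_def Q_def by (simp add: algebra_simps)
    moreover have "barrier_exponent N m c x y = 6 * c * (c + m * (real y + 1) - N * x) / W"
      unfolding barrier_exponent_def W_def P_def Q_def by simp
    moreover have "6 * c * (c + m * (real y + 1) - N * x) / W - 6 * c * (c + m * (real y + 1) - N * x - m) / (W - Q * m)
      = 6 * c * (m * W - Q * m * (c + m * (real y + 1) - N * x)) / (W * (W - Q * m))"
      using W W1 by (simp add: divide_simps) (simp add: algebra_simps)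
    moreover have "m * W - Q * m * (c + m * (real y + 1) - N * x) = m * (3 * S * N * x - Q * c)"
      unfolding W_def P_def Q_def S_def by (simp add: algebra_simps)
    ultimately show ?thesis using W1 unfolding z2_def mult.assoc by simp
  qed
  have z1_nonneg: "0 \<le> z1" if "x > 0"
    unfolding z1_def using s1[OF that] W N c pos by (intro divide_nonneg_nonneg mult_nonneg_nonneg add_nonneg_nonneg) auto
  have main: "real x * exp (- z1) + real y * exp z2 \<le> real x + real y"
  proof (cases "x = 0")
    case True
    show ?thesis
    proof (cases "y = 0")
      case False
      have "z2 \<le> 0" unfolding z2_def using s2 False W N c pos True
        by (intro divide_nonpos_nonneg mult_nonneg_nonpos) auto
      then show ?thesis using True by (simp add: mult_left_le)
    qed (use True in simp)
  next
    case x: False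
    show ?thesis
    proof (cases "y = 0")
      case True
      then show ?thesis using z1_nonneg x by (simp add: mult_left_le)
    next
      case y: False
      \<comment> \<open>Rescaling the point (N x, m y) by \<open>\<theta>\<close> makes the continuous inequality dominate both finite
        differences.\<close>
      define \<theta> where "\<theta> = W / (W - Q * m)"
      have W2: "0 < W - Q * m" and W1: "0 < W - P * N" using s1 s2 x y by auto
      have \<theta>: "1 \<le> \<theta>" unfolding \<theta>_def using W2 N pos by simp
      \<comment> \<open>\<open>W\<close> contains the weight of \<open>y + 1\<close> and
        \<open>W - Q m\<close> that of \<open>y\<close>, so the claim amounts to
        \<open>P N x \<ge> 0\<close>. It is what yields \<open>w1 \<le> z1\<close>.\<close>
      have \<theta>y: "\<theta> * y \<le> real y + 1"
      proof -
        have "W * y \<le> (real y + 1) * (W - Q * m)"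
          unfolding W_def using N pos by (simp add: algebra_simps)
        then show ?thesis unfolding \<theta>_def using W2 by (simp add: field_simps)
      qed
      have W\<theta>: "P * (\<theta> * (N * x)) + Q * (\<theta> * (m * y)) = W"
      proof -
        have "P * (\<theta> * (N * x)) + Q * (\<theta> * (m * y)) = \<theta> * (W - Q * m)"
          unfolding W_def by (simp add: algebra_simps)
        then show ?thesis unfolding \<theta>_def using W2 by simp
      qed
      define w1 where "w1 = 6 * c * N * (P * c + 3 * S * (\<theta> * (m * y))) / W\<^sup>2"
      define w2 where "w2 = 6 * c * m * (3 * S * (\<theta> * (N * x)) - Q * c) / W\<^sup>2"
      have "N * (\<theta> * (m * y)) * (exp w2 - 1) \<le> m * (\<theta> * (N * x)) * (1 - exp (- w1))"
        using drift_inequality[of N m c "\<theta> * (N * x)" "\<theta> * (m * y)"] N c \<theta> x y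
        unfolding w1_def w2_def P_def[symmetric] Q_def[symmetric] S_def[symmetric] W\<theta> by simp
      then have "(N * \<theta> * m) * (y * (exp w2 - 1)) \<le> (N * \<theta> * m) * (x * (1 - exp (- w1)))"
        by (simp add: algebra_simps)
      then have LD: "y * (exp w2 - 1) \<le> x * (1 - exp (- w1))"
        using N \<theta> by (simp add: mult_le_cancel_left_pos)
      have "w1 \<le> z1"
        unfolding w1_def z1_def
      proof (rule frac_le)
        show "W * (W - P * N) \<le> W\<^sup>2" using W N pos by (simp add: power2_eq_square)
        have "m * (\<theta> * y) \<le> m * (real y + 1)" using \<theta>y N by simp
        then show "6 * c * N * (P * c + 3 * S * (\<theta> * (m * y))) \<le> 6 * c * N * (P * c + 3 * S * m * (real y + 1))"
          using N c pos by (simp add: mult.left_commute mult.assoc)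
      qed (use W W1 N c pos in \<open>auto intro!: mult_nonneg_nonneg add_nonneg_nonneg\<close>)
      have "z2 \<le> w2"
      proof -
        have "z2 = 6 * c * m * (\<theta> * (3 * S * N * x - Q * c)) / W\<^sup>2"
          unfolding z2_def \<theta>_def using W W2 by (simp add: power2_eq_square ac_simps)
        also have "\<dots> \<le> w2"
          unfolding w2_def
        proof (intro divide_right_mono mult_left_mono)
          have "Q * c * 1 \<le> Q * c * \<theta>" using \<theta> pos c by (intro mult_left_mono) auto
          then show "\<theta> * (3 * S * N * x - Q * c) \<le> 3 * S * (\<theta> * (N * x)) - Q * c"
            by (simp add: algebra_simps)
        qed (use N c in auto)
        finally show ?thesis .
      qed
      have "x * exp (- z1) + y * exp z2 \<le> x * exp (- w1) + y * exp w2"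
        using \<open>w1 \<le> z1\<close> \<open>z2 \<le> w2\<close> by (intro add_mono mult_left_mono) auto
      also have "\<dots> \<le> real x + real y" using LD by (simp add: algebra_simps)
      finally show ?thesis .
    qed
  qed
  have e1: "real x * exp (- barrier_exponent N m c (real x - 1) y) = real x * exp (- z1) * exp (- barrier_exponent N m c x y)"
    using s1 by (cases "x = 0") (auto simp: exp_add[symmetric])
  have e2: "real y * exp (- barrier_exponent N m c x (real y - 1)) = real y * exp z2 * exp (- barrier_exponent N m c x y)"
    using s2 by (cases "y = 0") (auto simp: exp_add[symmetric])
  show ?thesis unfolding e1 e2 using mult_right_mono[OF main, of "exp (- barrier_exponent N m c x y)"]
    by (simp add: algebra_simps)
qed

section \<open>Subsets whose walk crosses the barrier\<close>

text \<open>A maximal inequality for the supermartingale \<open>\<phi>\<close>, in counting form.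
  The induction removes the least element of \<open>V\<close>: in the complement of \<open>Y\<close>
  it lowers x, in \<open>Y\<close> it lowers y. If the starting state already hits,
  \<open>\<phi> x y \<ge> 1\<close> makes the bound trivial.\<close>

lemma card_subsets_crossing_le:
  fixes \<phi> :: "nat \<Rightarrow> nat \<Rightarrow> real" and V :: "'a::linorder set"
  assumes nonneg: "\<And>x y. 0 \<le> \<phi> x y" and hit: "\<And>x y. hit x y \<Longrightarrow> 1 \<le> \<phi> x y"
    and step: "\<And>x y. real x * \<phi> (x - 1) y + real y * \<phi> x (y - 1) \<le> (real x + real y) * \<phi> x y"
    and "finite V" and "card V = x + y"
  shows "real (card {Y. Y \<subseteq> V \<and> card Y = y \<and> (\<exists>u. hit (card {v \<in> V - Y. u \<le> v}) (card {v \<in> Y. u \<le> v}))})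
    \<le> \<phi> x y * real ((x + y) choose y)"
  using assms(4,5)
proof (induction "x + y" arbitrary: V x y)
  case 0
  then have e: "x = 0" "y = 0" "V = {}" by auto
  show ?case
  proof (cases "hit 0 0")
    case True
    have "{Y. Y \<subseteq> V \<and> card Y = y \<and> (\<exists>u. hit (card {v \<in> V - Y. u \<le> v}) (card {v \<in> Y. u \<le> v}))} \<subseteq> {{}}"
      unfolding e by blast
    from card_mono[OF _ this] show ?thesis using hit[OF True] unfolding e by simp
  next
    case False
    then have none: "{Y. Y \<subseteq> V \<and> card Y = y \<and> (\<exists>u. hit (card {v \<in> V - Y. u \<le> v}) (card {v \<in> Y. u \<le> v}))} = {}"
      unfolding e by simp
    show ?thesis unfolding none using nonneg[of x y] by simp
  qed
next
  case (Suc k x y V)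
  define crossing where "crossing V Y \<longleftrightarrow> (\<exists>u. hit (card {v \<in> V - Y. u \<le> v}) (card {v \<in> Y. u \<le> v}))" for V Y :: "'a set"
  let ?C = "\<lambda>V y. {Y. Y \<subseteq> V \<and> card Y = y \<and> crossing V Y}"
  have "real (card (?C V y)) \<le> \<phi> x y * real ((x + y) choose y)"
  proof (cases "hit x y")
    case True
    have "card (?C V y) \<le> card {Y. Y \<subseteq> V \<and> card Y = y}"
      using Suc.prems by (intro card_mono) (auto intro: finite_subset[of _ "Pow V"])
    also have "\<dots> = (x + y) choose y" using Suc.prems by (simp add: n_subsets)
    finally have "real (card (?C V y)) \<le> 1 * real ((x + y) choose y)" by simp
    also have "\<dots> \<le> \<phi> x y * real ((x + y) choose y)" using hit[OF True] by (intro mult_right_mono) auto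
    finally show ?thesis .
  next
    case no_hit: False
    have "V \<noteq> {}" using Suc.hyps(2) Suc.prems by auto
    define v0 where "v0 = Min V"
    define V' where "V' = V - {v0}"
    have v0: "v0 \<in> V" "\<And>v. v \<in> V \<Longrightarrow> v0 \<le> v" using \<open>V \<noteq> {}\<close> Suc.prems by (auto simp: v0_def)
    have V': "finite V'" "card V' = k" "v0 \<notin> V'" "V = insert v0 V'"
      using Suc.hyps(2) Suc.prems v0(1) by (auto simp: V'_def)
    have cross': "crossing V' (Y - {v0})" if Y: "Y \<in> ?C V y" for Y
    proof -
      obtain u where u: "hit (card {v \<in> V - Y. u \<le> v}) (card {v \<in> Y. u \<le> v})"
        using Y unfolding crossing_def by auto
      have Yf: "finite Y" using Y Suc.prems finite_subset by auto
      \<comment> \<open>A threshold at or below the least element shows the starting state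
        \<open>(x, y)\<close>, which does not hit. So the crossing survives the removal of
        \<open>v0\<close>.\<close>
      have "\<not> u \<le> v0"
      proof
        assume "u \<le> v0"
        then have "{v \<in> V - Y. u \<le> v} = V - Y" "{v \<in> Y. u \<le> v} = Y" using v0 Y by force+
        moreover have "card (V - Y) = x" using Y Suc.prems Yf by (simp add: card_Diff_subset)
        ultimately show False using u Y no_hit by auto
      qed
      then have "{v \<in> V - Y. u \<le> v} = {v \<in> V' - (Y - {v0}). u \<le> v}" "{v \<in> Y. u \<le> v} = {v \<in> Y - {v0}. u \<le> v}"
        unfolding V'_def by auto
      then show ?thesis using u unfolding crossing_def by metis
    qed
    define S1 where "S1 = ?C V' y"
    \<comment> \<open>For \<open>y = 0\<close> no candidate contains \<open>v0\<close>, whereas the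
      truncated \<open>y - 1\<close> would let the empty set count.\<close>
    define S2 where "S2 = (if y = 0 then {} else ?C V' (y - 1))"
    have "?C V y \<subseteq> S1 \<union> insert v0 ` S2"
    proof
      fix Y assume Y: "Y \<in> ?C V y"
      have Yf: "finite Y" using Y Suc.prems finite_subset by auto
      show "Y \<in> S1 \<union> insert v0 ` S2"
      proof (cases "v0 \<in> Y")
        case False
        then have "Y - {v0} = Y" by auto
        then show ?thesis using Y cross'[OF Y] False unfolding S1_def V'_def by auto
      next
        case True
        then have "y > 0" using Y Yf by (auto simp: card_gt_0_iff)
        moreover have "Y - {v0} \<in> S2"
          using Y cross'[OF Y] True Yf \<open>y > 0\<close> unfolding S2_def V'_def by (simp add: Diff_mono)
        moreover have "Y = insert v0 (Y - {v0})" using True by auto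
        ultimately show ?thesis by blast
      qed
    qed
    moreover have finS: "finite S1" "finite S2"
      using V'(1) unfolding S1_def S2_def by (auto intro: finite_subset[of _ "Pow V'"])
    ultimately have "card (?C V y) \<le> card (S1 \<union> insert v0 ` S2)" by (intro card_mono) auto
    also have "\<dots> \<le> card S1 + card (insert v0 ` S2)" by (rule card_Un_le)
    also have "\<dots> \<le> card S1 + card S2" using card_image_le[OF finS(2)] by auto
    finally have le: "real (card (?C V y)) \<le> real (card S1) + real (card S2)" by linarith
    let ?n = "x + y"
    \<comment> \<open>The absorption identities produce the urn weights: a share
      \<open>x / (x + y)\<close> of the y-subsets avoids \<open>v0\<close>, a share
      \<open>y / (x + y)\<close> contains it.\<close>
    have 1: "real ?n * real (card S1) \<le> real x * \<phi> (x - 1) y * real (?n choose y)"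
    proof (cases "x = 0")
      case True
      have "card Y \<noteq> y" if "Y \<subseteq> V'" for Y
        using card_mono[OF V'(1) that] V'(2) Suc.hyps(2) True by auto
      then have "S1 = {}" unfolding S1_def by auto
      then show ?thesis using True by simp
    next
      case False
      have "real (card S1) \<le> \<phi> (x - 1) y * real ((x - 1 + y) choose y)"
        unfolding S1_def crossing_def using Suc.hyps(2) V' False by (intro Suc.hyps(1)) auto
      then have "real ?n * real (card S1) \<le> real ?n * (\<phi> (x - 1) y * real ((x - 1 + y) choose y))"
        by (rule mult_left_mono) simp
      also have "x - 1 + y = ?n - 1" using False by simp
      also have "real ?n * (\<phi> (x - 1) y * real ((?n - 1) choose y)) = \<phi> (x - 1) y * real (?n * ((?n - 1) choose y))"
        by (simp only: of_nat_mult mult.left_commute)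
      also have "?n * ((?n - 1) choose y) = x * (?n choose y)"
        using binomial_absorb_comp[of ?n y] by simp
      finally show ?thesis by (simp add: mult_ac)
    qed
    have 2: "real ?n * real (card S2) \<le> real y * \<phi> x (y - 1) * real (?n choose y)"
    proof (cases "y = 0")
      case True
      then show ?thesis by (simp add: S2_def)
    next
      case False
      then have "S2 = ?C V' (y - 1)" by (simp add: S2_def)
      then have "real (card S2) \<le> \<phi> x (y - 1) * real ((x + (y - 1)) choose (y - 1))"
        unfolding crossing_def using Suc.hyps(2) V' False by (simp only:) (intro Suc.hyps(1), auto)
      then have "real ?n * real (card S2) \<le> real ?n * (\<phi> x (y - 1) * real ((x + (y - 1)) choose (y - 1)))"
        by (rule mult_left_mono) simp
      also have "x + (y - 1) = ?n - 1" using False by simp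
      also have "real ?n * (\<phi> x (y - 1) * real ((?n - 1) choose (y - 1))) = \<phi> x (y - 1) * real (?n * ((?n - 1) choose (y - 1)))"
        by (simp only: of_nat_mult mult.left_commute)
      also have "?n * ((?n - 1) choose (y - 1)) = y * (?n choose y)"
        using times_binomial_minus1_eq[of y ?n] False by simp
      finally show ?thesis by (simp add: mult_ac)
    qed
    have "real ?n * real (card (?C V y)) \<le> (real x * \<phi> (x - 1) y + real y * \<phi> x (y - 1)) * real (?n choose y)"
      using 1 2 mult_left_mono[OF le, of "real ?n"] by (simp add: algebra_simps)
    also have "\<dots> \<le> (real x + real y) * \<phi> x y * real (?n choose y)"
      by (intro mult_right_mono step) auto
    finally have "real ?n * real (card (?C V y)) \<le> real ?n * (\<phi> x y * real (?n choose y))" by (simp add: mult_ac)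
    then show ?thesis using Suc.hyps(2) by (subst (asm) mult_le_cancel_left_pos) auto
  qed
  then show ?case unfolding crossing_def .
qed

text \<open>The p-values are multiples of \<open>1 / (n + 1)\<close>, so finitely many levels
  \<open>l\<close> stand for all thresholds in (0, 1). The calibration set \<open>K\<close> is a
  parameter because its role is passed on to every other n-subset of the pool.\<close>

definition rank_excess :: "nat \<Rightarrow> nat \<Rightarrow> real \<Rightarrow> (nat \<Rightarrow> real) \<Rightarrow> nat set \<Rightarrow> nat set \<Rightarrow> bool" where
  "rank_excess n r \<epsilon> s K H \<longleftrightarrow> (\<exists>l\<in>{1..n}. real r * (real l / (real n + 1) + \<epsilon>)
     < real (card {i \<in> H. 1 + card {j \<in> K. s i \<le> s j} \<le> l}))"

text \<open>Without ties, sets of indices are sets of scores. An excess at level \<open>l\<close> is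
  a crossing of the walk from \<open>(r, n)\<close>, so the count is at most the barrier value there
  times the number of subsets.\<close>

lemma card_rank_excess_le:
  fixes s :: "nat \<Rightarrow> real"
  assumes J: "finite J" "card J = n + r" and r: "0 < r" and \<epsilon>: "0 < \<epsilon>" and inj: "inj_on s J" and n: "0 < n"
  shows "real (card {K. K \<subseteq> J \<and> card K = n \<and> rank_excess n r \<epsilon> s K (J - K)})
    \<le> exp (- 2 * tau_nr n r * \<epsilon>\<^sup>2) * real ((n + r) choose n)"
proof -
  define N where "N = real n + 1"
  define m where "m = real r"
  define c where "c = \<epsilon> * N * m"
  define \<phi> where "\<phi> x y = exp (- barrier_exponent N m c (real x) (real y))" for x y :: nat
  define hit where "hit x y \<longleftrightarrow> c + m * (real y + 1) < N * real x" for x y :: nat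
  have pos: "0 < N" "0 < m" "0 < c" using r \<epsilon> by (auto simp: N_def m_def c_def)
  have hit1: "1 \<le> \<phi> x y" if "hit x y" for x y
  proof -
    have "barrier_exponent N m c (real x) (real y) \<le> 0"
      unfolding barrier_exponent_def using that pos unfolding hit_def
      by (intro divide_nonpos_nonneg mult_nonneg_nonpos) auto
    then show ?thesis unfolding \<phi>_def by simp
  qed
  have step: "real x * \<phi> (x - 1) y + real y * \<phi> x (y - 1) \<le> (real x + real y) * \<phi> x y" for x y
  proof -
    have "real x * \<phi> (x - 1) y = real x * exp (- barrier_exponent N m c (real x - 1) (real y))"
      by (cases "x = 0") (auto simp: \<phi>_def of_nat_diff)
    moreover have "real y * \<phi> x (y - 1) = real y * exp (- barrier_exponent N m c (real x) (real y - 1))"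
      by (cases "y = 0") (auto simp: \<phi>_def of_nat_diff)
    ultimately show ?thesis using barrier_supersolution[OF pos, of x y] by (simp only: \<phi>_def[of x y])
  qed
  let ?V = "s ` J"
  let ?S = "{Y. Y \<subseteq> ?V \<and> card Y = n \<and> (\<exists>u. hit (card {v \<in> ?V - Y. u \<le> v}) (card {v \<in> Y. u \<le> v}))}"
  let ?R = "{K. K \<subseteq> J \<and> card K = n \<and> rank_excess n r \<epsilon> s K (J - K)}"
  have sub: "(`) s ` ?R \<subseteq> ?S"
  proof
    fix Y assume "Y \<in> (`) s ` ?R"
    then obtain K where K: "K \<subseteq> J" "card K = n" "rank_excess n r \<epsilon> s K (J - K)" and Y: "Y = s ` K" by auto
    obtain l where l: "l \<in> {1..n}"
      and ex: "real r * (real l / (real n + 1) + \<epsilon>) < real (card {i \<in> J - K. 1 + card {j \<in> K. s i \<le> s j} \<le> l})"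
      using K(3) unfolding rank_excess_def by auto
    define T where "T = {i \<in> J - K. 1 + card {j \<in> K. s i \<le> s j} \<le> l}"
    have fin: "finite T" "finite K" using J K finite_subset unfolding T_def by auto
    have "0 < real (card T)" using ex \<epsilon> unfolding T_def[symmetric]
      by (smt (verit) divide_nonneg_nonneg mult_nonneg_nonneg of_nat_0_le_iff)
    then have "T \<noteq> {}" by auto
    then obtain i0 where i0: "i0 \<in> T" "\<And>i. i \<in> T \<Longrightarrow> s i0 \<le> s i"
      using fin(1) arg_min_if_finite[of T s] by (metis not_le)
    \<comment> \<open>\<open>T\<close> is an upper set among the null scores, so at threshold
      \<open>u\<close> exactly \<open>card T\<close> nulls remain, with at most \<open>l - 1\<close>
      calibration scores. The \<open>+ 1\<close> of the p-value becomes the \<open>y + 1\<close> of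
      \<open>hit\<close>.\<close>
    define u where "u = s i0"
    have injK: "inj_on s (J - K)" "inj_on s K" using inj K by (auto intro: inj_on_subset)
    have VY: "?V - Y = s ` (J - K)" unfolding Y using inj K(1) by (simp add: inj_on_image_set_diff)
    have "{v \<in> ?V - Y. u \<le> v} = s ` T"
    proof -
      have "i \<in> T" if i: "i \<in> J - K" "u \<le> s i" for i
      proof -
        have "card {j \<in> K. s i \<le> s j} \<le> card {j \<in> K. s i0 \<le> s j}"
          using i(2) fin(2) unfolding u_def by (intro card_mono) auto
        then show ?thesis using i0(1) i(1) unfolding T_def by auto
      qed
      then show ?thesis unfolding VY using i0 unfolding u_def T_def by auto
    qed
    then have c1: "card {v \<in> ?V - Y. u \<le> v} = card T"
      using inj_on_subset[OF injK(1), of T] by (simp add: card_image T_def subset_iff)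
    have "{v \<in> Y. u \<le> v} = s ` {j \<in> K. s i0 \<le> s j}" unfolding Y u_def by auto
    then have "card {v \<in> Y. u \<le> v} = card {j \<in> K. s i0 \<le> s j}"
      using inj_on_subset[OF injK(2), of "{j \<in> K. s i0 \<le> s j}"] by (simp add: card_image subset_iff)
    then have c2: "real (card {v \<in> Y. u \<le> v}) + 1 \<le> real l" using i0(1) unfolding T_def by auto
    have "c + m * (real (card {v \<in> Y. u \<le> v}) + 1) \<le> c + m * real l"
      using c2 pos by simp
    also have "\<dots> = N * (m * (real l / N + \<epsilon>))" using pos by (simp add: c_def field_simps)
    also have "\<dots> < N * real (card T)"
      using ex pos unfolding T_def[symmetric] N_def m_def by (intro mult_strict_left_mono) auto
    finally have "hit (card {v \<in> ?V - Y. u \<le> v}) (card {v \<in> Y. u \<le> v})"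
      unfolding hit_def c1 .
    then show "Y \<in> ?S" using K(1,2) Y injK(2) by (auto simp: card_image)
  qed
  have "finite ?S" using J by (auto intro: finite_subset[of _ "Pow ?V"])
  moreover have "inj_on ((`) s) ?R" using inj_on_image_Pow[OF inj] by (rule inj_on_subset) auto
  ultimately have "real (card ?R) \<le> real (card ?S)" using sub by (intro of_nat_mono card_inj_on_le)
  also have "real (card ?S) \<le> \<phi> r n * real ((r + n) choose n)"
    using hit1 step J inj by (intro card_subsets_crossing_le) (auto simp: \<phi>_def card_image)
  also have "\<phi> r n \<le> exp (- 2 * tau_nr n r * \<epsilon>\<^sup>2)"
  proof -
    \<comment> \<open>At the start \<open>m (n + 1) = N r\<close>, so the numerator keeps only
      \<open>c\<close> and the two parts of the denominator merge into
      \<open>3 (N + m) N m\<close>.\<close>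
    have "barrier_exponent N m c (real r) (real n) = 6 * c * c / (3 * (N + m) * N * m)"
      unfolding barrier_exponent_def N_def[symmetric] m_def[symmetric] by (simp add: algebra_simps)
    also have "\<dots> = 2 * \<epsilon>\<^sup>2 * (N * m / (N + m))"
    proof -
      have "6 * (\<epsilon> * q) * (\<epsilon> * q) / (3 * w * q) = 2 * \<epsilon>\<^sup>2 * (q / w)" if "0 < q" "0 < w" for q w :: real
        using that by (simp add: divide_simps power2_eq_square)
      from this[of "N * m" "N + m"] show ?thesis using pos by (simp add: c_def mult.assoc)
    qed
    also have "\<dots> \<ge> 2 * \<epsilon>\<^sup>2 * tau_nr n r"
    proof (intro mult_left_mono)
      have "tau_nr n r = m - m\<^sup>2 / (real n + m)"
        unfolding tau_nr_def m_def using n by (simp add: field_simps power2_eq_square)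
      also have "\<dots> \<le> m - m\<^sup>2 / (N + m)"
        using n pos by (intro diff_left_mono divide_left_mono) (auto simp: N_def)
      also have "\<dots> = N * m / (N + m)" using pos by (simp add: field_simps power2_eq_square)
      finally show "tau_nr n r \<le> N * m / (N + m)" .
    qed auto
    finally show ?thesis unfolding \<phi>_def by (simp add: mult.commute mult.left_commute)
  qed
  finally show ?thesis by (simp add: add.commute mult_right_mono)
qed

section \<open>The iterated DKW radius\<close>

text \<open>The quotient \<open>ln (1 + z) / z\<close> is nonincreasing; the form without division
  admits \<open>y = 0\<close>.\<close>

lemma mult_ln_one_plus_le:
  fixes y z :: real
  assumes "0 \<le> y" "y \<le> z"
  shows "y * ln (1 + z) \<le> z * ln (1 + y)"
proof -
  have "y / (1 + y) \<le> ln (1 + y)"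
    using ln_le_minus_one[of "1 / (1 + y)"] assms by (simp add: ln_div field_simps)
  then have d: "y / (1 + x) \<le> ln (1 + y)" if "y \<le> x" for x
    using that assms by (smt (verit) divide_left_mono mult_pos_pos)
  have "(\<lambda>z. z * ln (1 + y) - y * ln (1 + z)) y \<le> (\<lambda>z. z * ln (1 + y) - y * ln (1 + z)) z"
  proof (rule DERIV_nonneg_imp_nondecreasing[OF assms(2)])
    fix x assume x: "y \<le> x" "x \<le> z"
    have "((\<lambda>z. z * ln (1 + y) - y * ln (1 + z)) has_real_derivative ln (1 + y) - y / (1 + x)) (at x)"
      using x assms by (auto intro!: derivative_eq_intros simp: field_simps)
    then show "\<exists>D. ((\<lambda>z. z * ln (1 + y) - y * ln (1 + z)) has_real_derivative D) (at x) \<and> 0 \<le> D"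
      using d[OF x(1)] by auto
  qed
  then show ?thesis by simp
qed

section \<open>Range and tail level of the iterates\<close>

lemma Psi_DKW_bounds:
  assumes "0 < \<delta>" "\<delta> < 1" "0 \<le> x"
  shows "0 \<le> Psi_DKW \<delta> n r x" "Psi_DKW \<delta> n r x \<le> 1"
  using assms by (auto simp: Psi_DKW_def tau_nr_def intro!: divide_nonneg_nonneg add_nonneg_nonneg ln_ge_zero mult_nonneg_nonneg)

lemma lambda_DKW_Suc: "lambda_DKW (Suc k) \<delta> n r = Psi_DKW \<delta> n r (lambda_DKW k \<delta> n r)"
  by (simp add: lambda_DKW_def)

lemma lambda_DKW_nonneg:
  assumes "0 < \<delta>" "\<delta> < 1"
  shows "0 \<le> lambda_DKW k \<delta> n r"
proof (induction k)
  case 0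
  then show ?case by (simp add: lambda_DKW_def)
next
  case (Suc k)
  then show ?case unfolding lambda_DKW_Suc by (rule Psi_DKW_bounds(1)[OF assms])
qed

text \<open>The cap at 1 either binds, and then the envelope is vacuous, or the radius is the square
  root. In that case dropping the nonnegative logarithmic correction leaves
  \<open>2 \<tau> \<lambda>^2 \<ge> ln (1 / \<delta>)\<close>.\<close>

lemma lambda_DKW_cases:
  assumes \<delta>: "0 < \<delta>" "\<delta> < 1" and k: "1 \<le> k" and n: "0 < n" and r: "0 < r"
  obtains (one) "lambda_DKW k \<delta> n r = 1"
  | (tail) "0 < lambda_DKW k \<delta> n r" "exp (- 2 * tau_nr n r * (lambda_DKW k \<delta> n r)\<^sup>2) \<le> \<delta>"
proof -
  obtain j where j: "k = Suc j" using k by (cases k) auto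
  define x where "x = lambda_DKW j \<delta> n r"
  define y where "y = ln (1 + sqrt (2 * pi) * 2 * tau_nr n r * x / sqrt (real n + real r))"
  define q where "q = (ln (1 / \<delta>) + y) / (2 * tau_nr n r)"
  have x: "0 \<le> x" unfolding x_def by (rule lambda_DKW_nonneg[OF \<delta>])
  have \<tau>: "0 < tau_nr n r" using n r by (simp add: tau_nr_def)
  have y: "0 \<le> y" unfolding y_def using x \<tau> by (intro ln_ge_zero) simp
  have L: "0 < ln (1 / \<delta>)" using \<delta> by simp
  have lam: "lambda_DKW k \<delta> n r = min 1 (sqrt q)"
    unfolding j lambda_DKW_Suc Psi_DKW_def q_def y_def x_def ..
  have q: "0 < q" unfolding q_def using L y \<tau> by simp
  show thesis
  proof (cases "1 \<le> sqrt q")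
    case True
    then show ?thesis using lam one by simp
  next
    case False
    then have l: "lambda_DKW k \<delta> n r = sqrt q" using lam by simp
    have "2 * tau_nr n r * (lambda_DKW k \<delta> n r)\<^sup>2 = ln (1 / \<delta>) + y"
      unfolding l using q \<tau> by (simp add: q_def)
    also have "\<dots> \<ge> ln (1 / \<delta>)" using y by simp
    finally have "- 2 * tau_nr n r * (lambda_DKW k \<delta> n r)\<^sup>2 \<le> ln \<delta>" using \<delta> by (simp add: ln_div)
    then have "exp (- 2 * tau_nr n r * (lambda_DKW k \<delta> n r)\<^sup>2) \<le> exp (ln \<delta>)"
      by (rule iffD2[OF exp_le_cancel_iff])
    then show ?thesis using tail l q \<delta> by simp
  qed
qed

text \<open>Let \<open>z = D w / (n + r)^(3/2)\<close>, which decreases in \<open>r\<close>. Since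
  \<open>ln (1 + z) / z\<close> is nonincreasing, \<open>(n + r)^(3/2) ln (1 + z)\<close> is
  nondecreasing in \<open>r\<close>; the remaining factor \<open>r / sqrt (n + r)\<close> is
  nondecreasing too.\<close>

lemma mult_ln_decay_mono:
  fixes n r r' w D :: real
  assumes n: "0 < n" and r: "0 < r" "r \<le> r'" and w: "0 \<le> w" "0 \<le> D"
  shows "r * (n + r) * ln (1 + D * w / ((n + r) * sqrt (n + r)))
    \<le> r' * (n + r') * ln (1 + D * w / ((n + r') * sqrt (n + r')))"
proof -
  define s s' where "s = n + r" and "s' = n + r'"
  define q q' where "q = sqrt s" and "q' = sqrt s'"
  define z z' where "z = D * w / (s * q)" and "z' = D * w / (s' * q')"
  have s: "0 < s" "s \<le> s'" using n r by (auto simp: s_def s'_def)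
  have q: "0 < q" "q \<le> q'" using s by (auto simp: q_def q'_def)
  have z'0: "0 \<le> z'" unfolding z'_def using w s q by (intro divide_nonneg_nonneg mult_nonneg_nonneg) auto
  have zz: "z' * (s' * q') = z * (s * q)" unfolding z_def z'_def using s q by simp
  have "s * q \<le> s' * q'" using s q by (intro mult_mono) auto
  then have "z' \<le> z" unfolding z_def z'_def using s q w by (intro divide_left_mono) auto
  have rq: "r * q' \<le> r' * q"
  proof -
    have "r\<^sup>2 * s' \<le> r'\<^sup>2 * s"
    proof -
      have "r\<^sup>2 * n \<le> r'\<^sup>2 * n" using r n by (intro mult_right_mono power_mono) auto
      moreover have "r * r' * r \<le> r * r' * r'" using r by (intro mult_left_mono) auto
      ultimately show ?thesis unfolding s_def s'_def by (simp add: power2_eq_square algebra_simps)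
    qed
    then have "(r * q')\<^sup>2 \<le> (r' * q)\<^sup>2" using s unfolding q_def q'_def by (simp add: power_mult_distrib)
    then show ?thesis using r q by (simp add: power2_le_iff_abs_le)
  qed
  have lnz': "0 \<le> ln (1 + z')" using z'0 by simp
  have "r * s * ln (1 + z) \<le> r' * s' * ln (1 + z')"
  proof (cases "z' = 0")
    case True
    then have "z = 0" using zz s q by simp
    then show ?thesis using True by simp
  next
    case False
    then have z': "0 < z'" using z'0 by simp
    have "z' * ln (1 + z) \<le> z * ln (1 + z')" using mult_ln_one_plus_le[OF z'0 \<open>z' \<le> z\<close>] .
    then have "(s * q) * (z' * ln (1 + z)) \<le> (s * q) * (z * ln (1 + z'))"
      using s q by (intro mult_left_mono) auto
    also have "\<dots> = z' * (s' * q' * ln (1 + z'))" using zz by (simp add: algebra_simps)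
    finally have "s * q * ln (1 + z) \<le> s' * q' * ln (1 + z')"
      using z' by (simp add: mult.left_commute mult_le_cancel_left_pos)
    then have "r * (s * q * ln (1 + z)) \<le> r * (s' * q' * ln (1 + z'))" using r by (intro mult_left_mono) auto
    also have "\<dots> = (r * q') * (s' * ln (1 + z'))" by simp
    also have "\<dots> \<le> (r' * q) * (s' * ln (1 + z'))" using rq s lnz' by (intro mult_right_mono) auto
    finally have "q * (r * s * ln (1 + z)) \<le> q * (r' * s' * ln (1 + z'))" by (simp add: mult_ac)
    then show ?thesis using q by (simp add: mult_le_cancel_left_pos)
  qed
  then show ?thesis unfolding z_def z'_def q_def q'_def s_def s'_def .
qed

text \<open>Lets an overestimate of the number of nulls replace that number. The iteration is
  followed in the variable \<open>w = r x\<close>: there one step is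
  \<open>min r (sqrt (G r w))\<close>, and \<open>G\<close> is nondecreasing in both
  arguments.\<close>

lemma mult_lambda_DKW_mono:
  assumes \<delta>: "0 < \<delta>" "\<delta> < 1" and n: "0 < n" and r: "0 < r" "r \<le> r'"
  shows "real r * lambda_DKW k \<delta> n r \<le> real r' * lambda_DKW k \<delta> n r'"
proof (induction k)
  case 0
  then show ?case using r by (simp add: lambda_DKW_def)
next
  case (Suc k)
  define D where "D = sqrt (2 * pi) * 2 * real n"
  define G where "G r w = (real r * (real n + real r) * ln (1 / \<delta>)
    + real r * (real n + real r) * ln (1 + D * w / ((real n + real r) * sqrt (real n + real r)))) / (2 * real n)"
    for r :: nat and w :: real
  have eq: "real r * Psi_DKW \<delta> n r x = min (real r) (sqrt (G r (real r * x)))" if r: "0 < r" for r x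
  proof -
    have arg: "sqrt (2 * pi) * 2 * tau_nr n r * x / sqrt (real n + real r)
      = D * (real r * x) / ((real n + real r) * sqrt (real n + real r))"
      unfolding tau_nr_def D_def by simp
    define Y where "Y = ln (1 + D * (real r * x) / ((real n + real r) * sqrt (real n + real r)))"
    have "G r (real r * x) = (real r)\<^sup>2 * ((ln (1 / \<delta>) + Y) / (2 * tau_nr n r))"
      unfolding G_def Y_def[symmetric] tau_nr_def using n r
      by (simp add: divide_simps power2_eq_square) (simp add: algebra_simps)
    then have "sqrt (G r (real r * x)) = real r * sqrt ((ln (1 / \<delta>) + Y) / (2 * tau_nr n r))"
      by (simp only: real_sqrt_mult real_sqrt_abs abs_of_nat)
    then show ?thesis unfolding Psi_DKW_def arg Y_def[symmetric] by (simp add: min_mult_distrib_left)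
  qed
  define w w' where "w = real r * lambda_DKW k \<delta> n r" and "w' = real r' * lambda_DKW k \<delta> n r'"
  have w: "0 \<le> w" "w \<le> w'" using Suc lambda_DKW_nonneg[OF \<delta>] by (auto simp: w_def w'_def)
  have D: "0 \<le> D" by (simp add: D_def)
  have "real r * (real n + real r) * ln (1 + D * w / ((real n + real r) * sqrt (real n + real r)))
    \<le> real r * (real n + real r) * ln (1 + D * w' / ((real n + real r) * sqrt (real n + real r)))"
  proof (intro mult_left_mono iffD2[OF ln_le_cancel_iff] add_left_mono divide_right_mono)
    show "0 < 1 + D * w / ((real n + real r) * sqrt (real n + real r))"
      using D w by (intro add_pos_nonneg divide_nonneg_nonneg mult_nonneg_nonneg) auto
    show "0 < 1 + D * w' / ((real n + real r) * sqrt (real n + real r))"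
      using D w by (intro add_pos_nonneg divide_nonneg_nonneg mult_nonneg_nonneg) auto
  qed (use D w in auto)
  also have "\<dots> \<le> real r' * (real n + real r') * ln (1 + D * w' / ((real n + real r') * sqrt (real n + real r')))"
    using n r w D by (intro mult_ln_decay_mono) auto
  finally have 1: "real r * (real n + real r) * ln (1 + D * w / ((real n + real r) * sqrt (real n + real r)))
    \<le> real r' * (real n + real r') * ln (1 + D * w' / ((real n + real r') * sqrt (real n + real r')))" .
  have 2: "real r * (real n + real r) * ln (1 / \<delta>) \<le> real r' * (real n + real r') * ln (1 / \<delta>)"
    using r \<delta> by (intro mult_right_mono mult_mono) auto
  have "G r w \<le> G r' w'"
    unfolding G_def using 1 2 by (intro divide_right_mono add_mono) auto
  then have "min (real r) (sqrt (G r w)) \<le> min (real r') (sqrt (G r' w'))"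
    using r by (intro min.mono) auto
  then show ?case unfolding lambda_DKW_Suc using eq r w_def w'_def by simp
qed

section \<open>Exchangeability of the scores\<close>

lemma rank_excess_image:
  assumes "inj_on \<pi> (K \<union> H)"
  shows "rank_excess n r \<epsilon> s (\<pi> ` K) (\<pi> ` H) \<longleftrightarrow> rank_excess n r \<epsilon> (s \<circ> \<pi>) K H"
proof -
  have "card {j \<in> \<pi> ` K. s (\<pi> i) \<le> s j} = card {j \<in> K. s (\<pi> i) \<le> s (\<pi> j)}" for i
  proof -
    have "{j \<in> \<pi> ` K. s (\<pi> i) \<le> s j} = \<pi> ` {j \<in> K. s (\<pi> i) \<le> s (\<pi> j)}" by auto
    moreover have "inj_on \<pi> {j \<in> K. s (\<pi> i) \<le> s (\<pi> j)}" using assms by (rule inj_on_subset) auto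
    ultimately show ?thesis by (simp add: card_image)
  qed
  then have "{i \<in> \<pi> ` H. 1 + card {j \<in> \<pi> ` K. s i \<le> s j} \<le> l}
    = \<pi> ` {i \<in> H. 1 + card {j \<in> K. s (\<pi> i) \<le> s (\<pi> j)} \<le> l}" for l
    by auto
  moreover have "inj_on \<pi> {i \<in> H. 1 + card {j \<in> K. s (\<pi> i) \<le> s (\<pi> j)} \<le> l}" for l
    using assms by (rule inj_on_subset) auto
  ultimately show ?thesis unfolding rank_excess_def by (simp add: card_image)
qed

section \<open>Permutations, measurability and laws of permuted data\<close>

lemma exists_permutes_image:
  assumes J: "finite J" "A \<subseteq> J" "B \<subseteq> J" and card: "card A = card B"
  obtains \<pi> where "\<pi> permutes J" "\<pi> ` A = B"
proof -
  have fin: "finite A" "finite B" using J finite_subset by auto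
  obtain f where f: "bij_betw f A B" using finite_same_card_bij[OF fin card] by auto
  have "card (J - A) = card (J - B)" using J fin card by (simp add: card_Diff_subset)
  then obtain h where h: "bij_betw h (J - A) (J - B)" using finite_same_card_bij[of "J - A" "J - B"] J(1) by auto
  define \<pi> where "\<pi> x = (if x \<in> A then f x else if x \<in> J then h x else x)" for x
  have 1: "bij_betw \<pi> A B" using f by (subst bij_betw_cong[where g = f]) (auto simp: \<pi>_def)
  have 2: "bij_betw \<pi> (J - A) (J - B)" using h by (subst bij_betw_cong[where g = h]) (auto simp: \<pi>_def)
  have "bij_betw \<pi> (A \<union> (J - A)) (B \<union> (J - B))" using bij_betw_combine[OF 1 2] by auto
  then have "bij_betw \<pi> J J" using J by (simp add: Un_absorb1)
  then have "\<pi> permutes J" by (rule bij_imp_permutes) (use J in \<open>auto simp: \<pi>_def\<close>)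
  moreover have "\<pi> ` A = B" using 1 by (simp add: bij_betw_def)
  ultimately show thesis by (rule that)
qed

text \<open>Finitely many predicates have finitely many truth patterns, so the event is a finite
  union over the patterns satisfying \<open>Q\<close>. This spares separate measurability arguments
  for the cardinalities in \<open>rank_excess\<close>.\<close>

lemma pred_finite_Collect:
  assumes D: "finite D" and P: "\<And>d. d \<in> D \<Longrightarrow> Measurable.pred M (P d)"
  shows "Measurable.pred M (\<lambda>\<omega>. Q {d \<in> D. P d \<omega>})"
proof -
  have "Q {d \<in> D. P d \<omega>} \<longleftrightarrow> (\<exists>E\<in>{E \<in> Pow D. Q E}. \<forall>d\<in>D. P d \<omega> \<longleftrightarrow> d \<in> E)" for \<omega>
  proof
    assume "Q {d \<in> D. P d \<omega>}"
    then show "\<exists>E\<in>{E \<in> Pow D. Q E}. \<forall>d\<in>D. P d \<omega> \<longleftrightarrow> d \<in> E"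
      by (intro bexI[of _ "{d \<in> D. P d \<omega>}"]) auto
  next
    assume "\<exists>E\<in>{E \<in> Pow D. Q E}. \<forall>d\<in>D. P d \<omega> \<longleftrightarrow> d \<in> E"
    then obtain E where "E \<subseteq> D" "Q E" "\<forall>d\<in>D. P d \<omega> \<longleftrightarrow> d \<in> E" by auto
    moreover from this have "{d \<in> D. P d \<omega>} = E" by auto
    ultimately show "Q {d \<in> D. P d \<omega>}" by simp
  qed
  moreover have "Measurable.pred M (\<lambda>\<omega>. \<exists>E\<in>{E \<in> Pow D. Q E}. \<forall>d\<in>D. P d \<omega> \<longleftrightarrow> d \<in> E)"
  proof (intro pred_intros_finite(4) pred_intros_finite(3) D)
    fix E d assume "d \<in> D"
    from P[OF this] have [measurable]: "Measurable.pred M (P d)" .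
    show "Measurable.pred M (\<lambda>\<omega>. P d \<omega> \<longleftrightarrow> d \<in> E)" by measurable
  qed (use D in auto)
  ultimately show ?thesis by simp
qed

text \<open>The joint law is a product and permuting coordinates permutes its factors. The variables
  need not be identically distributed: it suffices that the permutation preserves each marginal, so
  points with other laws may stay fixed.\<close>

lemma (in prob_space) distr_permuted_indep_vars:
  assumes indep: "indep_vars (\<lambda>_. N) X I" and I: "I \<noteq> {}"
    and \<pi>: "\<pi> permutes I" and same: "\<And>i. i \<in> I \<Longrightarrow> distr M N (X (\<pi> i)) = distr M N (X i)"
  shows "distr M (PiM I (\<lambda>_. N)) (\<lambda>\<omega>. \<lambda>i\<in>I. X (\<pi> i) \<omega>) = distr M (PiM I (\<lambda>_. N)) (\<lambda>\<omega>. \<lambda>i\<in>I. X i \<omega>)"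
proof -
  have rv: "random_variable N (X i)" if "i \<in> I" for i using indep that by (auto simp: indep_vars_def)
  let ?D = "\<lambda>i. distr M N (X i)"
  have \<pi>I: "\<pi> i \<in> I" if "i \<in> I" for i using permutes_in_image[OF \<pi>] that by simp
  have law: "distr M (PiM I (\<lambda>_. N)) (\<lambda>\<omega>. \<lambda>i\<in>I. X i \<omega>) = PiM I ?D"
    by (rule iffD1[OF indep_vars_iff_distr_eq_PiM'[OF I rv] indep])
  have m1: "(\<lambda>\<omega>. \<lambda>i\<in>I. X i \<omega>) \<in> measurable M (PiM I (\<lambda>_. N))"
    using rv by (intro measurable_restrict) auto
  have m2: "(\<lambda>x. \<lambda>i\<in>I. x (\<pi> i)) \<in> measurable (PiM I (\<lambda>_. N)) (PiM I (\<lambda>_. N))"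
    using \<pi>I by (intro measurable_restrict measurable_component_singleton) auto
  have "distr M (PiM I (\<lambda>_. N)) (\<lambda>\<omega>. \<lambda>i\<in>I. X (\<pi> i) \<omega>)
    = distr (distr M (PiM I (\<lambda>_. N)) (\<lambda>\<omega>. \<lambda>i\<in>I. X i \<omega>)) (PiM I (\<lambda>_. N)) (\<lambda>x. \<lambda>i\<in>I. x (\<pi> i))"
    unfolding distr_distr[OF m2 m1] by (intro distr_cong) (auto simp: \<pi>I restrict_def)
  also have "\<dots> = distr (PiM I ?D) (PiM I (\<lambda>i. ?D (\<pi> i))) (\<lambda>x. \<lambda>i\<in>I. x (\<pi> i))"
    unfolding law by (intro distr_cong sets_PiM_cong) auto
  also have "\<dots> = PiM I (\<lambda>i. ?D (\<pi> i))"
    using rv \<pi>I permutes_inj_on[OF \<pi>] by (intro distr_PiM_reindex) (auto intro: prob_space_distr)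
  also have "\<dots> = PiM I ?D" using same by (intro PiM_cong) auto
  finally show ?thesis using law by simp
qed

text \<open>Each n-subset \<open>K\<close> of the pool \<open>J\<close> of calibration and null test
  indices gives an event \<open>B K\<close> of the same probability as \<open>E\<close>. Summing
  over \<open>K\<close> therefore compares that probability with the number of bad subsets at a
  fixed outcome, bounded by \<open>card_rank_excess_le\<close>.\<close>

lemma prob_rank_excess_le:
  fixes X T :: "nat \<Rightarrow> 'o \<Rightarrow> 'x::topological_space"
  assumes M: "prob_space M" and n: "0 < n" and r: "card H = r" "0 < r" and H: "H \<subseteq> {1..m}" and \<epsilon>: "0 < \<epsilon>"
    and indep: "prob_space.indep_vars M (\<lambda>_. borel) (\<lambda>i. case i of Inl j \<Rightarrow> X j | Inr j \<Rightarrow> T j)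
                  (Inl ` {1..n + m} \<union> Inr ` {1..n0 - n})"
    and null: "\<And>j. j \<in> {1..n} \<union> (+) n ` H \<Longrightarrow> distr M borel (X j) = P0"
    and g_meas: "(\<lambda>(tr, xs, x). g tr xs x) \<in> borel_measurable
                   (PiM {1..n0 - n} (\<lambda>_. borel) \<Otimes>\<^sub>M (PiM {1..n + m} (\<lambda>_. borel) \<Otimes>\<^sub>M borel))"
    and g_perm: "\<And>\<pi> tr xs x. \<pi> permutes {1..n + m} \<Longrightarrow> g tr (xs \<circ> \<pi>) x = g tr xs x"
    and no_ties: "AE \<omega> in M. inj_on (\<lambda>i. score g n0 n m T X i \<omega>) {1..n + m}"
  defines "E \<equiv> {\<omega> \<in> space M. rank_excess n r \<epsilon> (\<lambda>i. score g n0 n m T X i \<omega>) {1..n} ((+) n ` H)}"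
  shows "E \<in> sets M" "measure M E \<le> exp (- 2 * tau_nr n r * \<epsilon>\<^sup>2)"
proof -
  interpret prob_space M by fact
  define I where "I = {1..n + m}"
  define Idx where "Idx = (Inl ` I \<union> Inr ` {1..n0 - n} :: (nat + nat) set)"
  define Z where "Z i = (case i of Inl j \<Rightarrow> X j | Inr j \<Rightarrow> T j)" for i
  define \<Omega> where "\<Omega> = PiM Idx (\<lambda>_. borel :: 'x measure)"
  define V where "V \<omega> = (\<lambda>i\<in>Idx. Z i \<omega>)" for \<omega>
  define sc where "sc i z = g (\<lambda>j\<in>{1..n0 - n}. z (Inr j)) (\<lambda>j\<in>I. z (Inl j)) (z (Inl i))"
    for i :: nat and z :: "nat + nat \<Rightarrow> 'x"
  define J where "J = {1..n} \<union> (+) n ` H"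
  define bad where "bad K z \<longleftrightarrow> rank_excess n r \<epsilon> (\<lambda>i. sc i z) K (J - K)" for K z
  have indepZ: "indep_vars (\<lambda>_. borel) Z Idx" using indep unfolding Z_def[abs_def] Idx_def I_def .
  have JI: "J \<subseteq> I" using H by (auto simp: J_def I_def)
  have finJ: "finite J" using JI finite_subset unfolding I_def by auto
  have nH: "J - {1..n} = (+) n ` H" using H by (auto simp: J_def)
  have finH: "finite H" using H finite_subset by auto
  have "card J = card {1..n} + card ((+) n ` H)"
    unfolding J_def using H finH by (intro card_Un_disjoint) auto
  then have cardJ: "card J = n + r" using r by (simp add: card_image)
  have rvZ: "Z i \<in> borel_measurable M" if "i \<in> Idx" for i
    using indepZ that by (auto simp: indep_vars_def)
  have V_meas: "V \<in> measurable M \<Omega>"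
    unfolding V_def[abs_def] \<Omega>_def using rvZ by (intro measurable_restrict) auto
  have sc_meas: "sc i \<in> borel_measurable \<Omega>" if "i \<in> I" for i
  proof -
    have "(\<lambda>z. (\<lambda>j\<in>{1..n0 - n}. z (Inr j), \<lambda>j\<in>I. z (Inl j), z (Inl i)))
      \<in> measurable \<Omega> (PiM {1..n0 - n} (\<lambda>_. borel) \<Otimes>\<^sub>M (PiM I (\<lambda>_. borel) \<Otimes>\<^sub>M borel))"
      unfolding \<Omega>_def using that
      by (intro measurable_Pair measurable_restrict measurable_component_singleton) (auto simp: Idx_def)
    from measurable_compose[OF this g_meas[folded I_def]] show ?thesis
      by (simp add: sc_def[abs_def])
  qed
  have bad_meas: "Measurable.pred \<Omega> (bad K)" if K: "K \<subseteq> J" for K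
  proof -
    \<comment> \<open>The event depends on the scores only through their pairwise comparisons;
      \<open>Q\<close> reads it off the relation \<open>E\<close> formed by them.\<close>
    define Q where "Q E \<longleftrightarrow> (\<exists>l\<in>{1..n}. real r * (real l / (real n + 1) + \<epsilon>)
      < real (card {i \<in> J - K. 1 + card {j \<in> K. (i, j) \<in> E} \<le> l}))" for E
    have "bad K z = Q {d \<in> J \<times> J. sc (fst d) z \<le> sc (snd d) z}" for z
    proof -
      have "{j \<in> K. (i, j) \<in> {d \<in> J \<times> J. sc (fst d) z \<le> sc (snd d) z}} = {j \<in> K. sc i z \<le> sc j z}" if "i \<in> J - K" for i
        using that K by auto
      then have "{i \<in> J - K. 1 + card {j \<in> K. (i, j) \<in> {d \<in> J \<times> J. sc (fst d) z \<le> sc (snd d) z}} \<le> l}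
        = {i \<in> J - K. 1 + card {j \<in> K. sc i z \<le> sc j z} \<le> l}" for l
        by auto
      then show ?thesis unfolding bad_def rank_excess_def Q_def by simp
    qed
    then have "bad K = (\<lambda>z. Q {d \<in> J \<times> J. sc (fst d) z \<le> sc (snd d) z})" by (rule ext)
    moreover have "Measurable.pred \<Omega> (\<lambda>z. Q {d \<in> J \<times> J. sc (fst d) z \<le> sc (snd d) z})"
    proof (intro pred_finite_Collect)
      show "finite (J \<times> J)" using finJ by simp
      fix d assume "d \<in> J \<times> J"
      then have "sc (fst d) \<in> borel_measurable \<Omega>" "sc (snd d) \<in> borel_measurable \<Omega>"
        using JI sc_meas by auto
      then show "Measurable.pred \<Omega> (\<lambda>z. sc (fst d) z \<le> sc (snd d) z)"
        unfolding pred_def by (rule borel_measurable_le)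
    qed
    ultimately show ?thesis by simp
  qed
  define B where "B K = {\<omega> \<in> space M. bad K (V \<omega>)}" for K
  have B_sets: "B K \<in> sets M" if "K \<subseteq> J" for K
    unfolding B_def using measurable_compose[OF V_meas bad_meas[OF that]] by (simp add: pred_def)
  have sc_score: "sc i (V \<omega>) = score g n0 n m T X i \<omega>" if "i \<in> I" for i \<omega>
  proof -
    have "(\<lambda>j\<in>{1..n0 - n}. V \<omega> (Inr j)) = (\<lambda>j\<in>{1..n0 - n}. T j \<omega>)"
      "(\<lambda>j\<in>I. V \<omega> (Inl j)) = (\<lambda>j\<in>I. X j \<omega>)" "V \<omega> (Inl i) = X i \<omega>"
      using that by (auto simp: V_def Z_def Idx_def fun_eq_iff)
    then show ?thesis by (simp add: sc_def score_def I_def)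
  qed
  have rank_excess_cong: "rank_excess n r \<epsilon> s K L \<longleftrightarrow> rank_excess n r \<epsilon> s' K L"
    if "\<And>i. i \<in> K \<union> L \<Longrightarrow> s i = s' i" for s s' K L
  proof -
    have "{i \<in> L. 1 + card {j \<in> K. s i \<le> s j} \<le> l} = {i \<in> L. 1 + card {j \<in> K. s' i \<le> s' j} \<le> l}" for l
    proof -
      have "{j \<in> K. s i \<le> s j} = {j \<in> K. s' i \<le> s' j}" if "i \<in> L" for i
        using that \<open>\<And>i. i \<in> K \<union> L \<Longrightarrow> s i = s' i\<close> by auto
      then show ?thesis by auto
    qed
    then show ?thesis unfolding rank_excess_def by simp
  qed
  have EB: "E = B {1..n}"
  proof -
    have "rank_excess n r \<epsilon> (\<lambda>i. score g n0 n m T X i \<omega>) {1..n} ((+) n ` H) \<longleftrightarrow> bad {1..n} (V \<omega>)" for \<omega>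
      unfolding bad_def nH using JI sc_score by (intro rank_excess_cong) (auto simp: J_def)
    then show ?thesis unfolding E_def B_def by simp
  qed
  show "E \<in> sets M" unfolding EB by (rule B_sets) (auto simp: J_def)
  have eq: "measure M (B K) = measure M E" if K: "K \<subseteq> J" "card K = n" for K
  proof -
    obtain \<pi> where \<pi>: "\<pi> permutes J" "\<pi> ` {1..n} = K"
      using exists_permutes_image[OF finJ, of "{1..n}" K] K by (auto simp: J_def)
    have \<pi>I: "\<pi> permutes I" using permutes_subset[OF \<pi>(1) JI] .
    \<comment> \<open>The training sample is left in place. Only indices in \<open>J\<close> move,
      and there all laws equal \<open>P0\<close>, so the joint law is preserved even when other test
      points have different laws.\<close>
    define \<pi>' where "\<pi>' = map_sum \<pi> (id :: nat \<Rightarrow> nat)"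
    have "\<pi>' permutes Idx"
    proof (rule bij_imp_permutes)
      have "\<pi>' ` Inl ` I = Inl ` \<pi> ` I" "\<pi>' ` Inr ` {1..n0 - n} = Inr ` {1..n0 - n}"
        by (simp_all add: image_image \<pi>'_def)
      then have "\<pi>' ` Idx = Idx" by (simp only: Idx_def image_Un permutes_image[OF \<pi>I])
      moreover have "inj \<pi>'" unfolding \<pi>'_def using permutes_inj[OF \<pi>I] by (intro sum.inj_map) auto
      ultimately show "bij_betw \<pi>' Idx Idx" unfolding bij_betw_def using inj_on_subset by blast
      show "\<pi>' x = x" if "x \<notin> Idx" for x
        using that permutes_not_in[OF \<pi>I] unfolding \<pi>'_def Idx_def by (cases x) auto
    qed
    moreover have "distr M borel (Z (\<pi>' i)) = distr M borel (Z i)" for i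
    proof (cases i)
      case (Inl j)
      show ?thesis
      proof (cases "j \<in> J")
        case True
        then have "\<pi> j \<in> J" using permutes_in_image[OF \<pi>(1)] by simp
        then show ?thesis using Inl True null unfolding J_def[symmetric] by (simp add: Z_def \<pi>'_def)
      next
        case False
        then show ?thesis using Inl permutes_not_in[OF \<pi>(1)] by (simp add: \<pi>'_def)
      qed
    qed (simp add: \<pi>'_def)
    moreover have "Idx \<noteq> {}" using n by (auto simp: Idx_def I_def)
    ultimately have law: "distr M \<Omega> (\<lambda>\<omega>. \<lambda>i\<in>Idx. Z (\<pi>' i) \<omega>) = distr M \<Omega> V"
      unfolding \<Omega>_def V_def[abs_def] by (intro distr_permuted_indep_vars indepZ)
    define V' where "V' \<omega> = (\<lambda>i\<in>Idx. Z (\<pi>' i) \<omega>)" for \<omega>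
    have V'_meas: "V' \<in> measurable M \<Omega>"
      unfolding V'_def[abs_def] \<Omega>_def using rvZ permutes_in_image[OF \<open>\<pi>' permutes Idx\<close>]
      by (intro measurable_restrict) auto
    \<comment> \<open>Permuting the sample leaves the score function unchanged by
      \<open>g_perm\<close>; only the point at which it is evaluated moves, so the scores are
      themselves permuted.\<close>
    have sc': "sc i (V' \<omega>) = sc (\<pi> i) (V \<omega>)" if "i \<in> I" for i \<omega>
    proof -
      have in_I: "\<pi> j \<in> I \<longleftrightarrow> j \<in> I" for j using permutes_in_image[OF \<pi>I] .
      have "(\<lambda>j\<in>{1..n0 - n}. V' \<omega> (Inr j)) = (\<lambda>j\<in>{1..n0 - n}. V \<omega> (Inr j))"
        by (auto simp: V'_def V_def Z_def Idx_def fun_eq_iff \<pi>'_def)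
      moreover have "(\<lambda>j\<in>I. V' \<omega> (Inl j)) = (\<lambda>j\<in>I. V \<omega> (Inl j)) \<circ> \<pi>"
        using in_I by (auto simp: V'_def V_def Z_def Idx_def fun_eq_iff \<pi>'_def)
      moreover have "V' \<omega> (Inl i) = V \<omega> (Inl (\<pi> i))"
        using in_I that by (auto simp: V'_def V_def Z_def Idx_def \<pi>'_def)
      ultimately show ?thesis unfolding sc_def using g_perm[OF \<pi>I[unfolded I_def]] by simp
    qed
    have "\<pi> ` (J - {1..n}) = J - K"
      using \<pi> permutes_image[OF \<pi>(1)] image_set_diff[OF permutes_inj[OF \<pi>(1)]] by metis
    then have "bad K (V \<omega>) \<longleftrightarrow> bad {1..n} (V' \<omega>)" for \<omega>
    proof -
      have "bad K (V \<omega>) \<longleftrightarrow> rank_excess n r \<epsilon> ((\<lambda>i. sc i (V \<omega>)) \<circ> \<pi>) {1..n} (J - {1..n})"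
        unfolding bad_def using rank_excess_image[of \<pi> "{1..n}" "J - {1..n}"] permutes_inj_on[OF \<pi>(1)]
          \<open>\<pi> ` (J - {1..n}) = J - K\<close> \<pi>(2) by metis
      also have "\<dots> \<longleftrightarrow> bad {1..n} (V' \<omega>)"
        unfolding bad_def using JI sc' by (intro rank_excess_cong) (auto simp: J_def)
      finally show ?thesis .
    qed
    then have BK: "B K = V' -` {z \<in> space \<Omega>. bad {1..n} z} \<inter> space M"
      unfolding B_def using measurable_space[OF V'_meas] by auto
    have E': "E = V -` {z \<in> space \<Omega>. bad {1..n} z} \<inter> space M"
      unfolding EB B_def using measurable_space[OF V_meas] by auto
    have S: "{z \<in> space \<Omega>. bad {1..n} z} \<in> sets \<Omega>"
      using bad_meas[of "{1..n}"] by (auto simp: pred_def J_def)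
    show ?thesis
      unfolding BK E' measure_distr[OF V'_meas S, symmetric] measure_distr[OF V_meas S, symmetric]
      using law by (simp add: V'_def[abs_def])
  qed
  define KK where "KK = {K. K \<subseteq> J \<and> card K = n}"
  have finKK: "finite KK" unfolding KK_def using finJ by (auto intro: finite_subset[of _ "Pow J"])
  have cardKK: "card KK = (n + r) choose n" unfolding KK_def using n_subsets[OF finJ] cardJ by simp
  have int: "integrable M (\<lambda>\<omega>. \<Sum>K\<in>KK. indicat_real (B K) \<omega>)"
    using B_sets by (intro Bochner_Integration.integrable_sum integrable_real_indicator)
      (auto simp: KK_def less_top[symmetric])
  have "real (card KK) * measure M E = (\<Sum>K\<in>KK. measure M (B K))"
    using eq by (simp add: KK_def)
  also have "\<dots> = (\<integral>\<omega>. (\<Sum>K\<in>KK. indicat_real (B K) \<omega>) \<partial>M)"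
    using B_sets by (subst Bochner_Integration.integral_sum)
      (auto simp: KK_def less_top[symmetric] intro!: sum.cong)
  also have "\<dots> \<le> exp (- 2 * tau_nr n r * \<epsilon>\<^sup>2) * real ((n + r) choose n)"
  proof (rule integral_le_const[OF int])
    \<comment> \<open>Pointwise the sum of indicators counts the bad subsets; the counting bound
      needs distinct scores, hence holds almost everywhere.\<close>
    show "AE \<omega> in M. (\<Sum>K\<in>KK. indicat_real (B K) \<omega>) \<le> exp (- 2 * tau_nr n r * \<epsilon>\<^sup>2) * real ((n + r) choose n)"
      using no_ties AE_space
    proof eventually_elim
      case (elim \<omega>)
      have "inj_on (\<lambda>i. sc i (V \<omega>)) J"
        using elim(1) sc_score JI unfolding I_def[symmetric] by (subst inj_on_cong[of J _ "\<lambda>i. score g n0 n m T X i \<omega>"]) (auto intro: inj_on_subset)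
      then have "real (card {K. K \<subseteq> J \<and> card K = n \<and> bad K (V \<omega>)})
          \<le> exp (- 2 * tau_nr n r * \<epsilon>\<^sup>2) * real ((n + r) choose n)"
        unfolding bad_def using finJ cardJ r \<epsilon> n by (intro card_rank_excess_le) auto
      moreover have "(\<Sum>K\<in>KK. indicat_real (B K) \<omega>) = real (card {K \<in> KK. bad K (V \<omega>)})"
        using finKK elim(2) by (simp add: indicator_def B_def sum.If_cases Int_def)
      ultimately show ?case by (simp add: KK_def conj_assoc)
    qed
  qed
  finally have "real ((n + r) choose n) * measure M E \<le> real ((n + r) choose n) * exp (- 2 * tau_nr n r * \<epsilon>\<^sup>2)"
    unfolding cardKK by (simp add: mult.commute)
  moreover have "0 < real ((n + r) choose n)" by simp
  ultimately show "measure M E \<le> exp (- 2 * tau_nr n r * \<epsilon>\<^sup>2)"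
    by (subst (asm) mult_le_cancel_left_pos)
qed

section \<open>False discovery proportion\<close>

lemma I_n_bounds:
  assumes "0 < t" "t < 1"
  shows "0 \<le> I_n n t" "I_n n t < 1"
proof -
  show "0 \<le> I_n n t" using assms by (simp add: I_n_def)
  have "real_of_int \<lfloor>(real n + 1) * t\<rfloor> \<le> (real n + 1) * t" by simp
  also have "\<dots> < (real n + 1) * 1" using assms by (intro mult_strict_left_mono) auto
  finally show "I_n n t < 1" by (simp add: I_n_def)
qed

text \<open>A threshold \<open>t\<close> acts on p-values in multiples of \<open>1 / (n + 1)\<close>
  only through \<open>l\<close>, the floor of \<open>(n + 1) t\<close>, and
  \<open>I_n n t = l / (n + 1)\<close>. As \<open>t < 1\<close>, \<open>l\<close> is at most
  \<open>n\<close>, the last level that \<open>rank_excess\<close> inspects.\<close>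

lemma card_null_rejections_le:
  assumes H: "H \<subseteq> {1..m}" "card H = r" and \<epsilon>: "0 \<le> \<epsilon>" and t: "0 < t" "t < 1"
    and good: "\<not> rank_excess n r \<epsilon> s {1..n} ((+) n ` H)"
  shows "real (card (rej_set m (conf_pval n s) t \<inter> H)) \<le> real r * I_n n t + real r * \<epsilon>"
proof -
  define l where "l = nat \<lfloor>(real n + 1) * t\<rfloor>"
  have fl: "0 \<le> \<lfloor>(real n + 1) * t\<rfloor>" using t by simp
  have In: "I_n n t = real l / (real n + 1)" using fl by (simp add: I_n_def l_def)
  have ln: "l \<le> n"
  proof -
    have "real l < real n + 1" using I_n_bounds(2)[OF t, of n] unfolding In by (simp add: field_simps)
    then show ?thesis by linarith
  qed
  have le: "conf_pval n s i \<le> t \<longleftrightarrow> 1 + card {j \<in> {1..n}. s (n + i) \<le> s j} \<le> l" for i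
  proof -
    define a where "a = card {j \<in> {1..n}. s (n + i) \<le> s j}"
    have "conf_pval n s i \<le> t \<longleftrightarrow> real_of_int (1 + int a) \<le> (real n + 1) * t"
      unfolding conf_pval_def a_def by (simp add: field_simps)
    also have "\<dots> \<longleftrightarrow> 1 + int a \<le> \<lfloor>(real n + 1) * t\<rfloor>" by (rule le_floor_iff[symmetric])
    also have "\<dots> \<longleftrightarrow> 1 + a \<le> l" unfolding l_def using fl by linarith
    finally show ?thesis unfolding a_def .
  qed
  have R: "rej_set m (conf_pval n s) t \<inter> H = {i \<in> H. 1 + card {j \<in> {1..n}. s (n + i) \<le> s j} \<le> l}"
    unfolding rej_set_def using H(1) le by auto
  show ?thesis
  \<comment> \<open>Level 0 is not covered by \<open>rank_excess\<close>, but every p-value is at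
    least \<open>1 / (n + 1)\<close>, so nothing is rejected there.\<close>
  proof (cases "l = 0")
    case True
    then show ?thesis unfolding R using \<epsilon> In by simp
  next
    case False
    then have "l \<in> {1..n}" using ln by simp
    then have "real (card {i \<in> (+) n ` H. 1 + card {j \<in> {1..n}. s i \<le> s j} \<le> l}) \<le> real r * (real l / (real n + 1) + \<epsilon>)"
      using good unfolding rank_excess_def by (meson not_less)
    moreover have "{i \<in> (+) n ` H. 1 + card {j \<in> {1..n}. s i \<le> s j} \<le> l}
      = (+) n ` (rej_set m (conf_pval n s) t \<inter> H)" unfolding R by auto
    ultimately show ?thesis unfolding In by (simp add: card_image distrib_left)
  qed
qed

text \<open>Every null is either rejected, and counted by the envelope, or has a p-value above
  \<open>t\<close>. Solving for \<open>r\<close> puts the true number of nulls into the set, so the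
  set is nonempty and its maximum is at least \<open>r\<close>.\<close>

lemma m0_bound_ge:
  assumes H: "H \<subseteq> {1..m}" "card H = r" and r: "0 < r"
    and good: "\<And>t. 0 < t \<Longrightarrow> t < 1 \<Longrightarrow>
      real (card (rej_set m p t \<inter> H)) \<le> real r * I_n n t + real r * lambda_DKW k \<delta> n r"
  shows "r \<le> m0_bound k \<delta> n m p"
proof -
  define A where "A = {r \<in> {1..m}. (INF t \<in> {0<..<1}. (real (card {i \<in> {1..m}. p i > t})
    + real r * lambda_DKW k \<delta> n r) / (1 - I_n n t)) \<ge> real r}"
  have finH: "finite H" using H finite_subset by auto
  have "real r \<le> (real (card {i \<in> {1..m}. p i > t}) + real r * lambda_DKW k \<delta> n r) / (1 - I_n n t)"
    if t: "t \<in> {0<..<1}" for t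
  proof -
    have "r = card (rej_set m p t \<inter> H) + card (H - rej_set m p t)"
      using card_Int_Diff[OF finH, of "rej_set m p t"] H by (simp add: Int_commute)
    moreover have "card (H - rej_set m p t) \<le> card {i \<in> {1..m}. p i > t}"
      using H by (intro card_mono) (auto simp: rej_set_def)
    ultimately have "real r \<le> real (card (rej_set m p t \<inter> H)) + real (card {i \<in> {1..m}. p i > t})"
      by linarith
    then have "real r * (1 - I_n n t) \<le> real (card {i \<in> {1..m}. p i > t}) + real r * lambda_DKW k \<delta> n r"
      using good[of t] t by (simp add: algebra_simps)
    then show ?thesis using I_n_bounds[of t n] t by (simp add: pos_le_divide_eq)
  qed
  then have "real r \<le> (INF t \<in> {0<..<1}. (real (card {i \<in> {1..m}. p i > t})
    + real r * lambda_DKW k \<delta> n r) / (1 - I_n n t))"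
    by (intro cINF_greatest) auto
  moreover have "r \<le> m" using card_mono[OF _ H(1)] H(2) by simp
  ultimately have "r \<in> A" unfolding A_def using r by simp
  moreover have "finite A" unfolding A_def by simp
  ultimately have "r \<le> Max A" "A \<noteq> {}" by auto
  then show ?thesis unfolding m0_bound_def Let_def A_def[symmetric] by simp
qed

section \<open>Combination on the complement of the rank excess event\<close>

theorem corollary2:
  fixes M :: "'o measure" and P0 :: "(real ^ 'd) measure"
    and X :: "nat \<Rightarrow> 'o \<Rightarrow> real ^ 'd" and T :: "nat \<Rightarrow> 'o \<Rightarrow> real ^ 'd"
    and g :: "(nat \<Rightarrow> real ^ 'd) \<Rightarrow> (nat \<Rightarrow> real ^ 'd) \<Rightarrow> real ^ 'd \<Rightarrow> real"
    and n0 n m k :: nat and \<delta> :: real and mhat :: "'o \<Rightarrow> nat"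
  assumes M: "prob_space M"
    and n: "1 < n" "n < n0"
    and k: "1 \<le> k"
    and \<delta>: "0 < \<delta>" "\<delta> < 1"
    and indep: "prob_space.indep_vars M (\<lambda>_. borel)
                  (\<lambda>i. case i of Inl j \<Rightarrow> X j | Inr j \<Rightarrow> T j)
                  (Inl ` {1..n + m} \<union> Inr ` {1..n0 - n})"
    and cal_null: "\<forall>j\<in>{1..n}. distr M borel (X j) = P0"
    and train_null: "\<forall>j\<in>{1..n0 - n}. distr M borel (T j) = P0"
    and g_meas: "(\<lambda>(tr, xs, x). g tr xs x) \<in> borel_measurable
                   (PiM {1..n0 - n} (\<lambda>_. borel) \<Otimes>\<^sub>M (PiM {1..n + m} (\<lambda>_. borel) \<Otimes>\<^sub>M borel))"
    and g_perm: "\<forall>\<pi> tr xs x. \<pi> permutes {1..n + m} \<longrightarrow> g tr (xs \<circ> \<pi>) x = g tr xs x"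
    and no_ties: "AE \<omega> in M. inj_on (\<lambda>i. score g n0 n m T X i \<omega>) {1..n + m}"
    and mhat_rv: "mhat \<in> measurable M (count_space UNIV)"
    and mhat_ge: "\<forall>\<omega>\<in>space M. mhat \<omega> \<ge>
                    m0_bound k \<delta> n m (conf_pval n (\<lambda>j. score g n0 n m T X j \<omega>))"
  shows "\<exists>A\<in>sets M. measure M A \<ge> 1 - \<delta> \<and>
           (\<forall>\<omega>\<in>A. \<forall>t\<in>{0<..<1::real}.
              FDP {i \<in> {1..m}. distr M borel (X (n + i)) = P0}
                  (rej_set m (conf_pval n (\<lambda>j. score g n0 n m T X j \<omega>)) t)
              \<le> (real (mhat \<omega>) * I_n n t + real (mhat \<omega>) * lambda_DKW k \<delta> n (mhat \<omega>))
                 / real (max 1 (card (rej_set m (conf_pval n (\<lambda>j. score g n0 n m T X j \<omega>)) t))))"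
proof -
  interpret prob_space M by fact
  define H where "H = {i \<in> {1..m}. distr M borel (X (n + i)) = P0}"
  define r where "r = card H"
  define \<epsilon> where "\<epsilon> = lambda_DKW k \<delta> n r"
  define s where "s \<omega> = (\<lambda>j. score g n0 n m T X j \<omega>)" for \<omega>
  define p where "p \<omega> = conf_pval n (s \<omega>)" for \<omega>
  define E where "E = {\<omega> \<in> space M. rank_excess n r \<epsilon> (s \<omega>) {1..n} ((+) n ` H)}"
  have H: "H \<subseteq> {1..m}" "card H = r" by (auto simp: H_def r_def)
  have \<epsilon>0: "0 \<le> \<epsilon>" unfolding \<epsilon>_def by (rule lambda_DKW_nonneg[OF \<delta>])
  show ?thesis
  proof (cases "r = 0")
    case True
    \<comment> \<open>Without nulls the false discovery proportion is 0 and the bound holds at every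
      outcome. The estimate ranges over positive \<open>r\<close>, so this case is separate.\<close>
    then have "H = {}" using H finite_subset[OF H(1)] by auto
    then show ?thesis
      unfolding H_def[symmetric] using lambda_DKW_nonneg[OF \<delta>] \<delta> I_n_bounds(1)
      by (intro bexI[of _ "space M"])
        (auto simp: FDP_def prob_space intro!: divide_nonneg_nonneg add_nonneg_nonneg mult_nonneg_nonneg)
  next
    case False
    then have r: "0 < r" by simp
    have "E \<in> sets M \<and> measure M E \<le> \<delta>"
      using \<delta>
    proof (rule lambda_DKW_cases[where k = k and n = n and r = r])
      \<comment> \<open>At most \<open>r\<close> nulls can be counted, so with a radius of 1 no
        excess is possible and \<open>E\<close> is empty.\<close>
      assume one: "lambda_DKW k \<delta> n r = 1"
      have "\<not> rank_excess n r \<epsilon> (s \<omega>) {1..n} ((+) n ` H)" for \<omega>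
      proof
        assume "rank_excess n r \<epsilon> (s \<omega>) {1..n} ((+) n ` H)"
        then obtain l where "real r * (real l / (real n + 1) + 1)
            < real (card {i \<in> (+) n ` H. 1 + card {j \<in> {1..n}. s \<omega> i \<le> s \<omega> j} \<le> l})"
          unfolding rank_excess_def \<epsilon>_def one by auto
        also have "card {i \<in> (+) n ` H. 1 + card {j \<in> {1..n}. s \<omega> i \<le> s \<omega> j} \<le> l} \<le> card ((+) n ` H)"
          using finite_subset[OF H(1)] by (intro card_mono) auto
        also have "card ((+) n ` H) = r" using H(2) by (simp add: card_image)
        finally have "real r * (real l / (real n + 1) + 1) < real r * 1" by simp
        moreover have "real r * 1 \<le> real r * (real l / (real n + 1) + 1)" by (intro mult_left_mono) auto
        ultimately show False by linarith
      qed
      then have "E = {}" unfolding E_def by simp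
      then show ?thesis using \<delta> by simp
    next
      assume tail: "0 < lambda_DKW k \<delta> n r" "exp (- 2 * tau_nr n r * (lambda_DKW k \<delta> n r)\<^sup>2) \<le> \<delta>"
      have null: "distr M borel (X j) = P0" if "j \<in> {1..n} \<union> (+) n ` H" for j
        using that cal_null by (auto simp: H_def)
      have perm: "g tr (xs \<circ> \<pi>) x = g tr xs x" if "\<pi> permutes {1..n + m}" for \<pi> tr xs x
        using g_perm that by blast
      have n0: "0 < n" using n by simp
      note * = prob_rank_excess_le[OF M n0 H(2) r H(1) tail(1) indep null g_meas perm no_ties]
      show ?thesis using * tail(2) unfolding E_def s_def \<epsilon>_def by (meson order_trans)
    qed (use k n r in auto)
    then have E: "E \<in> sets M" "measure M E \<le> \<delta>" by auto
    have bound: "FDP H (rej_set m (p \<omega>) t) \<le> (real (mhat \<omega>) * I_n n t + real (mhat \<omega>) * lambda_DKW k \<delta> n (mhat \<omega>))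
        / real (max 1 (card (rej_set m (p \<omega>) t)))"
      if \<omega>: "\<omega> \<in> space M - E" and t: "0 < t" "t < 1" for \<omega> t
    proof -
      have good: "\<not> rank_excess n r \<epsilon> (s \<omega>) {1..n} ((+) n ` H)" using \<omega> by (simp add: E_def)
      have count: "real (card (rej_set m (p \<omega>) t \<inter> H)) \<le> real r * I_n n t + real r * \<epsilon>" if "0 < t" "t < 1" for t
        unfolding p_def using card_null_rejections_le[OF H \<epsilon>0 that good] .
      have "r \<le> m0_bound k \<delta> n m (p \<omega>)" using m0_bound_ge[OF H r] count unfolding \<epsilon>_def by blast
      also have "\<dots> \<le> mhat \<omega>" using mhat_ge \<omega> unfolding p_def s_def by simp
      finally have rm: "r \<le> mhat \<omega>" .
      have "real (card (rej_set m (p \<omega>) t \<inter> H)) \<le> real r * I_n n t + real r * \<epsilon>" by (rule count[OF t])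
      \<comment> \<open>The radius may change when \<open>r\<close> is replaced by the estimate;
        what is monotone is its product with \<open>r\<close>.\<close>
      also have "\<dots> \<le> real (mhat \<omega>) * I_n n t + real (mhat \<omega>) * lambda_DKW k \<delta> n (mhat \<omega>)"
        unfolding \<epsilon>_def using rm I_n_bounds(1)[OF t] n r
        by (intro add_mono mult_right_mono mult_lambda_DKW_mono[OF \<delta>]) auto
      finally show ?thesis unfolding FDP_def by (simp add: max.commute divide_right_mono)
    qed
    show ?thesis
    proof (intro bexI[of _ "space M - E"] conjI ballI)
      show "1 - \<delta> \<le> measure M (space M - E)" using E by (simp add: prob_compl)
      show "space M - E \<in> sets M" using E by simp
    qed (use bound in \<open>auto simp: p_def s_def H_def\<close>)
  qed
qed

end
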